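(* Let $\mathcal{H}$ be a finite central irreducible real hyperplane arrangement with base region $B$. Then the interval $[\mathbbm{1},\Delta^2]$ in the pure shard monoid $\mathbf{P}^+(\mathcal{H},B)$ is self-dual, i.e. it is isomorphic as a poset to its order dual.
   Context: Regions of $\mathcal{H}$ are the connected components of $\mathbb{R}^n\setminus\bigcup\mathcal{H}$; $\mathrm{inv}(C,C')$ is the set of hyperplanes separating regions $C,C'$; $B$ is a fixed base region, $\mathrm{inv}(C)=\mathrm{inv}(B,C)$, and $-C$ is the region with $\mathrm{inv}(C,-C)=\mathcal{H}$. $\mathrm{Weak}(\mathcal{H},B)$ orders regions by inclusion of $\mathrm{inv}$. Irreducible: no linear automorphism $\theta$ and partition $\mathcal{H}=\mathcal{H}_1\sqcup\mathcal{H}_2$ into nonempty parts with all normals of $\theta(\mathcal{H}_1)$ orthogonal to all normals of $\theta(\mathcal{H}_2)$. Salvetti complex: vertices are regions; one directed edge $D\to D'$ for each ordered pair of regions separated by exactly one hyperplane; for a cover $C'\lessdot C$ in $\mathrm{Weak}(\mathcal{H},B)$, $e$ denotes the edge $C'\to C$ and $e^*$ the edge $C\to C'$. Positive galleries are directed edge paths, minimal if of length $|\mathrm{inv}(D,D')|$. For every codimension-2 face $F$ and region $C$ with $F\subseteq\overline C$, a 2-cell is glued along the two positive minimal galleries from $C$ to the region opposite $C$ about $F$ through regions whose closures contain $F$. $\pi_1(\mathrm{Sal}(\mathcal{H}),B)$ is its fundamental group based at $B$; $\mathrm{gal}(D,D')$ denotes any positive minimal gallery (all are homotopic). For a cover $C'\lessdot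 C$ with edge $e$, $\ell_e:=\mathrm{gal}(B,C')\, e\, e^*\,\mathrm{gal}(B,C')^{-1}$. The pure shard monoid $\mathbf{P}^+(\mathcal{H},B)$ is the submonoid of $\pi_1(\mathrm{Sal}(\mathcal{H}),B)$ generated by all the loops $\ell_e$, partially ordered by $p\le p'$ iff $p'=pq$ for some $q\in\mathbf{P}^+(\mathcal{H},B)$ (equivalently, some word in the generators representing $p'$ has a prefix representing $p$). The full twist is $\Delta^2:=\mathrm{gal}(B,-B)\cdot\mathrm{gal}(-B,B)$, which lies in $\mathbf{P}^+(\mathcal{H},B)$; $\mathbbm{1}$ is the identity. *)

theory Defs
  imports "HOL-Analysis.Analysis" "HOL-Algebra.Group"
begin

section \<open>Central hyperplane arrangements\<close>

definition normal_to :: "'a::euclidean_space \<Rightarrow> 'a set \<Rightarrow> bool" where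
  "normal_to a h \<longleftrightarrow> a \<noteq> 0 \<and> h = {x. a \<bullet> x = 0}"

definition central_arrangement :: "'a::euclidean_space set set \<Rightarrow> bool" where
  "central_arrangement \<H> \<longleftrightarrow> finite \<H> \<and> (\<forall>h\<in>\<H>. \<exists>a. normal_to a h)"

definition irreducible_arrangement :: "'a::euclidean_space set set \<Rightarrow> bool" where
  "irreducible_arrangement \<H> \<longleftrightarrow>
     \<not> (\<exists>(\<theta> :: 'a \<Rightarrow> 'a) \<H>1 \<H>2. linear \<theta> \<and> bij \<theta>
          \<and> \<H> = \<H>1 \<union> \<H>2 \<and> \<H>1 \<inter> \<H>2 = {} \<and> \<H>1 \<noteq> {} \<and> \<H>2 \<noteq> {}
          \<and> (\<forall>h1\<in>\<H>1. \<forall>h2\<in>\<H>2. \<forall>a b.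
               normal_to a (\<theta> ` h1) \<longrightarrow> normal_to b (\<theta> ` h2) \<longrightarrow> orthogonal a b))"

definition regions :: "'a::euclidean_space set set \<Rightarrow> 'a set set" where
  "regions \<H> = components (UNIV - \<Union>\<H>)"

definition separates :: "'a::euclidean_space set \<Rightarrow> 'a set \<Rightarrow> 'a set \<Rightarrow> bool" where
  "separates h C C' \<longleftrightarrow>
     (\<exists>a. normal_to a h \<and> (\<forall>x\<in>C. a \<bullet> x < 0) \<and> (\<forall>x\<in>C'. 0 < a \<bullet> x))"

definition inversions :: "'a::euclidean_space set set \<Rightarrow> 'a set \<Rightarrow> 'a set \<Rightarrow> 'a set set" where
  "inversions \<H> C C' = {h\<in>\<H>. separates h C C'}"

definition opposite :: "'a::euclidean_space set set \<Rightarrow> 'a set \<Rightarrow> 'a set" where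
  "opposite \<H> C = (THE D. D \<in> regions \<H> \<and> inversions \<H> C D = \<H>)"

definition weak_covers :: "'a::euclidean_space set set \<Rightarrow> 'a set \<Rightarrow> 'a set \<Rightarrow> 'a set \<Rightarrow> bool" where
  "weak_covers \<H> B C' C \<longleftrightarrow> C' \<in> regions \<H> \<and> C \<in> regions \<H>
     \<and> inversions \<H> B C' \<subset> inversions \<H> B C
     \<and> \<not> (\<exists>D\<in>regions \<H>. inversions \<H> B C' \<subset> inversions \<H> B D
                         \<and> inversions \<H> B D \<subset> inversions \<H> B C)"

text \<open>Faces are taken closed. In dimension 1 the value of \<^const>\<open>aff_dim\<close> required here
  is that of the empty set, which is not a face of the arrangement.\<close>

definition codim2_face :: "'a::euclidean_space set set \<Rightarrow> 'a set \<Rightarrow> bool" where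
  "codim2_face \<H> F \<longleftrightarrow> F \<noteq> {} \<and> (\<exists>C\<in>regions \<H>. F face_of closure C)
     \<and> aff_dim F = int DIM('a) - 2"

section \<open>Edge paths in the Salvetti complex\<close>

text \<open>A directed edge from \<open>D\<close> to \<open>D'\<close> can be traversed forwards (\<open>Fwd D D'\<close>) or
  backwards (\<open>Bwd D D'\<close>, which goes from \<open>D'\<close> to \<open>D\<close>). Note that \<open>Bwd D D'\<close> and \<open>Fwd D' D\<close>
  traverse two different edges.\<close>

datatype 'v step = Fwd 'v 'v | Bwd 'v 'v

fun step_source :: "'v step \<Rightarrow> 'v" where
  "step_source (Fwd D D') = D"
| "step_source (Bwd D D') = D'"

fun step_target :: "'v step \<Rightarrow> 'v" where
  "step_target (Fwd D D') = D'"
| "step_target (Bwd D D') = D"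

fun step_inverse :: "'v step \<Rightarrow> 'v step" where
  "step_inverse (Fwd D D') = Bwd D D'"
| "step_inverse (Bwd D D') = Fwd D D'"

definition path_inverse :: "'v step list \<Rightarrow> 'v step list" where
  "path_inverse p = rev (map step_inverse p)"

definition adjacent :: "'a::euclidean_space set set \<Rightarrow> 'a set \<Rightarrow> 'a set \<Rightarrow> bool" where
  "adjacent \<H> D D' \<longleftrightarrow> D \<in> regions \<H> \<and> D' \<in> regions \<H> \<and> card (inversions \<H> D D') = 1"

fun sal_step :: "'a::euclidean_space set set \<Rightarrow> 'a set step \<Rightarrow> bool" where
  "sal_step \<H> (Fwd D D') = adjacent \<H> D D'"
| "sal_step \<H> (Bwd D D') = adjacent \<H> D D'"

fun sal_path :: "'a::euclidean_space set set \<Rightarrow> 'a set \<Rightarrow> 'a set step list \<Rightarrow> 'a set \<Rightarrow> bool" where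
  "sal_path \<H> D [] D' = (D \<in> regions \<H> \<and> D = D')"
| "sal_path \<H> D (s # p) D' =
     (sal_step \<H> s \<and> step_source s = D \<and> sal_path \<H> (step_target s) p D')"

definition positive_gallery ::
    "'a::euclidean_space set set \<Rightarrow> 'a set \<Rightarrow> 'a set step list \<Rightarrow> 'a set \<Rightarrow> bool" where
  "positive_gallery \<H> D g D' \<longleftrightarrow> sal_path \<H> D g D' \<and> (\<forall>s\<in>set g. \<exists>E E'. s = Fwd E E')"

definition minimal_gallery ::
    "'a::euclidean_space set set \<Rightarrow> 'a set \<Rightarrow> 'a set step list \<Rightarrow> 'a set \<Rightarrow> bool" where
  "minimal_gallery \<H> D g D' \<longleftrightarrow>
     positive_gallery \<H> D g D' \<and> length g = card (inversions \<H> D D')"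

text \<open>The choice made here does not matter up to homotopy.\<close>

definition gal ::
    "'a::euclidean_space set set \<Rightarrow> 'a set \<Rightarrow> 'a set \<Rightarrow> 'a set step list" where
  "gal \<H> D D' = (SOME g. minimal_gallery \<H> D g D')"

definition opposite_about ::
    "'a::euclidean_space set set \<Rightarrow> 'a set \<Rightarrow> 'a set \<Rightarrow> 'a set \<Rightarrow> bool" where
  "opposite_about \<H> F C D \<longleftrightarrow> C \<in> regions \<H> \<and> D \<in> regions \<H>
     \<and> F \<subseteq> closure C \<and> F \<subseteq> closure D \<and> inversions \<H> C D = {h\<in>\<H>. F \<subseteq> h}"

definition gallery_around ::
    "'a::euclidean_space set set \<Rightarrow> 'a set \<Rightarrow> 'a set \<Rightarrow> 'a set step list \<Rightarrow> 'a set \<Rightarrow> bool" where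
  "gallery_around \<H> F C g D \<longleftrightarrow> minimal_gallery \<H> C g D
     \<and> (\<forall>s\<in>set g. F \<subseteq> closure (step_source s) \<and> F \<subseteq> closure (step_target s))"

text \<open>\<open>sal_cell \<H> g g'\<close> says that some 2-cell is glued in along the two galleries \<open>g\<close> and
  \<open>g'\<close>. (The case \<open>g = g'\<close> is not excluded; it has no effect on homotopy.)\<close>

definition sal_cell ::
    "'a::euclidean_space set set \<Rightarrow> 'a set step list \<Rightarrow> 'a set step list \<Rightarrow> bool" where
  "sal_cell \<H> g g' \<longleftrightarrow> (\<exists>F C D. codim2_face \<H> F \<and> opposite_about \<H> F C D
     \<and> gallery_around \<H> F C g D \<and> gallery_around \<H> F C g' D)"

section \<open>The fundamental group\<close>

text \<open>Homotopy of edge paths with fixed end points, in the combinatorial sense for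
  2-dimensional complexes: the equivalence relation generated by cancelling a step against its
  inverse and by pushing a path across a 2-cell.\<close>

inductive sal_homotopic ::
    "'a::euclidean_space set set \<Rightarrow> 'a set \<Rightarrow> 'a set \<Rightarrow> 'a set step list \<Rightarrow> 'a set step list \<Rightarrow> bool"
  for \<H> D D' where
  refl: "sal_path \<H> D p D' \<Longrightarrow> sal_homotopic \<H> D D' p p"
| sym: "sal_homotopic \<H> D D' p q \<Longrightarrow> sal_homotopic \<H> D D' q p"
| trans: "sal_homotopic \<H> D D' p q \<Longrightarrow> sal_homotopic \<H> D D' q r \<Longrightarrow> sal_homotopic \<H> D D' p r"
| cancel: "sal_path \<H> D (p @ [s, step_inverse s] @ q) D' \<Longrightarrow>
     sal_homotopic \<H> D D' (p @ [s, step_inverse s] @ q) (p @ q)"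
| cell: "sal_cell \<H> g g' \<Longrightarrow> sal_path \<H> D (p @ g @ q) D' \<Longrightarrow>
     sal_homotopic \<H> D D' (p @ g @ q) (p @ g' @ q)"

definition homotopy_class ::
    "'a::euclidean_space set set \<Rightarrow> 'a set \<Rightarrow> 'a set step list \<Rightarrow> 'a set step list set" where
  "homotopy_class \<H> B p = {q. sal_homotopic \<H> B B p q}"

definition sal_pi1 ::
    "'a::euclidean_space set set \<Rightarrow> 'a set \<Rightarrow> 'a set step list set monoid" where
  "sal_pi1 \<H> B =
     \<lparr> carrier = {homotopy_class \<H> B p | p. sal_path \<H> B p B},
       mult = (\<lambda>X Y. {r. \<exists>p\<in>X. \<exists>q\<in>Y. sal_homotopic \<H> B B (p @ q) r}),
       one = homotopy_class \<H> B [] \<rparr>"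

lemma sal_path_source: "sal_path \<H> D p D' \<Longrightarrow> D \<in> regions \<H>"
proof (induction p)
  case Nil
  then show ?case by auto
next
  case (Cons s q)
  then show ?case by (cases s) (auto simp: adjacent_def)
qed

lemma sal_path_target: "sal_path \<H> D p D' \<Longrightarrow> D' \<in> regions \<H>"
  by (induction p arbitrary: D) auto

lemma sal_path_append:
  "sal_path \<H> D (p @ q) D' \<longleftrightarrow> (\<exists>E. sal_path \<H> D p E \<and> sal_path \<H> E q D')"
  by (induction p arbitrary: D) (auto dest: sal_path_source)

lemma sal_path_inverse: "sal_path \<H> D p D' \<Longrightarrow> sal_path \<H> D' (path_inverse p) D"
proof (induction p arbitrary: D)
  case (Cons s p)
  then show ?case
    by (cases s) (auto simp: path_inverse_def sal_path_append adjacent_def)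
qed (simp add: path_inverse_def)

lemma sal_path_det: "sal_path \<H> D p E \<Longrightarrow> sal_path \<H> D p E' \<Longrightarrow> E = E'"
proof (induction p arbitrary: D)
  case Nil
  then show ?case by (metis sal_path.simps(1))
next
  case (Cons s p)
  then show ?case by (metis sal_path.simps(2))
qed

lemma sal_path_unique: "sal_path \<H> D p E \<Longrightarrow> sal_path \<H> D' p E' \<Longrightarrow> p \<noteq> [] \<Longrightarrow> D = D' \<and> E = E'"
  by (metis neq_Nil_conv sal_path.simps(2) sal_path_det)

lemma sal_cell_parallel:
  assumes "sal_cell \<H> g g'"
  obtains C D where "sal_path \<H> C g D" "sal_path \<H> C g' D" "length g' = length g"
  using assms
  by (auto simp: sal_cell_def gallery_around_def minimal_gallery_def positive_gallery_def)

lemma sal_homotopic_paths: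
  "sal_homotopic \<H> D D' p q \<Longrightarrow> sal_path \<H> D p D' \<and> sal_path \<H> D q D'"
proof (induction rule: sal_homotopic.induct)
  case (cancel p s q)
  then show ?case by (cases s) (auto simp: sal_path_append)
next
  case (cell g g' p q)
  obtain C E where *: "sal_path \<H> C g E" "sal_path \<H> C g' E" "length g' = length g"
    using sal_cell_parallel[OF cell(1)] by blast
  show ?case
  proof (cases "g = []")
    case False
    obtain C' E' where 1: "sal_path \<H> D p C'" "sal_path \<H> C' g E'" "sal_path \<H> E' q D'"
      using cell(2) by (auto simp: sal_path_append)
    have "C' = C" "E' = E"
      using sal_path_unique[OF 1(2) *(1) False] by simp_all
    then show ?thesis
      using 1 * cell(2) by (auto simp: sal_path_append)
  qed (use cell * in auto)
qed auto

lemma sal_homotopic_append_left: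
  assumes "sal_homotopic \<H> D E p p'" "sal_path \<H> C r D"
  shows "sal_homotopic \<H> C E (r @ p) (r @ p')"
  using assms
proof (induction rule: sal_homotopic.induct)
  case (refl p)
  then show ?case by (auto intro!: sal_homotopic.refl simp: sal_path_append)
next
  case (cancel p s q)
  then have "sal_path \<H> C ((r @ p) @ [s, step_inverse s] @ q) E"
    by (auto simp: sal_path_append)
  from sal_homotopic.cancel[OF this] show ?case by simp
next
  case (cell g g' p q)
  then have "sal_path \<H> C ((r @ p) @ g @ q) E"
    by (auto simp: sal_path_append)
  from sal_homotopic.cell[OF cell(1) this] show ?case by simp
next
  case (sym p q)
  then show ?case by (simp add: sal_homotopic.sym)
next
  case (trans p q r)
  then show ?case using sal_homotopic.trans by meson
qed

lemma sal_homotopic_append_right: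
  assumes "sal_homotopic \<H> C D p p'" "sal_path \<H> D r E"
  shows "sal_homotopic \<H> C E (p @ r) (p' @ r)"
  using assms
proof (induction rule: sal_homotopic.induct)
  case (refl p)
  then show ?case by (auto intro!: sal_homotopic.refl simp: sal_path_append)
next
  case (cancel p s q)
  then have "sal_path \<H> C (p @ [s, step_inverse s] @ (q @ r)) E"
    by (fastforce simp: sal_path_append)
  from sal_homotopic.cancel[OF this] show ?case by simp
next
  case (cell g g' p q)
  then have "sal_path \<H> C (p @ g @ (q @ r)) E"
    by (auto simp: sal_path_append)
  from sal_homotopic.cell[OF cell(1) this] show ?case by simp
next
  case (sym p q)
  then show ?case by (simp add: sal_homotopic.sym)
next
  case (trans p q r)
  then show ?case using sal_homotopic.trans by meson
qed

lemma sal_homotopic_append: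
  assumes "sal_homotopic \<H> C D p p'" "sal_homotopic \<H> D E q q'"
  shows "sal_homotopic \<H> C E (p @ q) (p' @ q')"
  by (rule sal_homotopic.trans[OF
        sal_homotopic_append_right[OF assms(1)] sal_homotopic_append_left[OF assms(2)]])
     (use sal_homotopic_paths[OF assms(1)] sal_homotopic_paths[OF assms(2)] in simp_all)

lemma sal_homotopic_inverse:
  "sal_path \<H> D p D' \<Longrightarrow> sal_homotopic \<H> D D (p @ path_inverse p) []"
proof (induction p arbitrary: D)
  case Nil
  then show ?case by (auto simp: path_inverse_def intro: sal_homotopic.refl)
next
  case (Cons s p)
  let ?E = "step_target s"
  have s: "sal_path \<H> D [s] ?E" and p: "sal_path \<H> ?E p D'"
    using Cons.prems sal_path_source[of \<H> ?E p D'] by auto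
  have s': "sal_path \<H> ?E [step_inverse s] D"
    using sal_path_inverse[OF s] by (auto simp: path_inverse_def)
  have "sal_homotopic \<H> D D ([s] @ (p @ path_inverse p) @ [step_inverse s])
      ([s] @ [] @ [step_inverse s])"
    by (intro sal_homotopic_append_left[OF _ s] sal_homotopic_append_right[OF _ s'] Cons.IH p)
  moreover have "sal_path \<H> D ([] @ [s, step_inverse s] @ []) D"
    using s s' sal_path_append[of \<H> D "[s]" "[step_inverse s]" D] by auto
  from sal_homotopic.cancel[OF this]
  have "sal_homotopic \<H> D D ([s] @ [] @ [step_inverse s]) []" by simp
  ultimately have "sal_homotopic \<H> D D ([s] @ (p @ path_inverse p) @ [step_inverse s]) []"
    by (rule sal_homotopic.trans)
  then show ?case
    by (simp add: path_inverse_def)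
qed

lemma homotopy_class_eq_iff:
  assumes "sal_path \<H> B p B"
  shows "homotopy_class \<H> B p = homotopy_class \<H> B q \<longleftrightarrow> sal_homotopic \<H> B B p q"
proof
  assume "homotopy_class \<H> B p = homotopy_class \<H> B q"
  moreover have "p \<in> homotopy_class \<H> B p"
    using assms by (simp add: homotopy_class_def sal_homotopic.refl)
  ultimately show "sal_homotopic \<H> B B p q"
    by (simp add: homotopy_class_def sal_homotopic.sym)
next
  assume pq: "sal_homotopic \<H> B B p q"
  have "sal_homotopic \<H> B B p r \<longleftrightarrow> sal_homotopic \<H> B B q r" for r
    using sal_homotopic.trans[OF pq] sal_homotopic.trans[OF sal_homotopic.sym[OF pq]] by blast
  then show "homotopy_class \<H> B p = homotopy_class \<H> B q"
    by (simp add: homotopy_class_def)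
qed

lemma sal_pi1_mult:
  assumes "sal_path \<H> B p B" "sal_path \<H> B q B"
  shows "homotopy_class \<H> B p \<otimes>\<^bsub>sal_pi1 \<H> B\<^esub> homotopy_class \<H> B q = homotopy_class \<H> B (p @ q)"
proof -
  have "sal_homotopic \<H> B B (p @ q) r"
    if "sal_homotopic \<H> B B p p'" "sal_homotopic \<H> B B q q'" "sal_homotopic \<H> B B (p' @ q') r"
    for p' q' r
    using sal_homotopic.trans[OF sal_homotopic_append[OF that(1,2)] that(3)] .
  moreover have "sal_homotopic \<H> B B p p" "sal_homotopic \<H> B B q q"
    using assms by (simp_all add: sal_homotopic.refl)
  ultimately show ?thesis
    unfolding sal_pi1_def homotopy_class_def by auto
qed

lemma group_sal_pi1:
  assumes "B \<in> regions \<H>"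
  shows "group (sal_pi1 \<H> B)"
proof -
  let ?c = "homotopy_class \<H> B"
  have car: "carrier (sal_pi1 \<H> B) = {?c p | p. sal_path \<H> B p B}"
    and one: "\<one>\<^bsub>sal_pi1 \<H> B\<^esub> = ?c []"
    by (simp_all add: sal_pi1_def)
  have nil: "sal_path \<H> B [] B" using assms by simp
  have app: "sal_path \<H> B (p @ q) B" if "sal_path \<H> B p B" "sal_path \<H> B q B" for p q
    using that by (auto simp: sal_path_append)
  show ?thesis
  proof (rule groupI)
    fix X assume "X \<in> carrier (sal_pi1 \<H> B)"
    then obtain p where p: "sal_path \<H> B p B" "X = ?c p" by (auto simp: car)
    have p': "sal_path \<H> B (path_inverse p) B" by (rule sal_path_inverse[OF p(1)])
    have "step_inverse (step_inverse t) = t" for t :: "'a set step"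
      by (cases t) simp_all
    then have "path_inverse (path_inverse p) = p"
      by (simp add: path_inverse_def rev_map[symmetric] comp_def)
    then have "sal_homotopic \<H> B B (path_inverse p @ p) []"
      using sal_homotopic_inverse[OF p'] by simp
    then have "?c (path_inverse p) \<otimes>\<^bsub>sal_pi1 \<H> B\<^esub> X = \<one>\<^bsub>sal_pi1 \<H> B\<^esub>"
      using p p' app by (simp add: sal_pi1_mult one homotopy_class_eq_iff)
    then show "\<exists>Y\<in>carrier (sal_pi1 \<H> B). Y \<otimes>\<^bsub>sal_pi1 \<H> B\<^esub> X = \<one>\<^bsub>sal_pi1 \<H> B\<^esub>"
      using p' by (auto simp: car)
  next
    fix X Y Z
    assume "X \<in> carrier (sal_pi1 \<H> B)" "Y \<in> carrier (sal_pi1 \<H> B)" "Z \<in> carrier (sal_pi1 \<H> B)"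
    then obtain p q r where "sal_path \<H> B p B" "sal_path \<H> B q B" "sal_path \<H> B r B"
      "X = ?c p" "Y = ?c q" "Z = ?c r" unfolding car by blast
    then show "X \<otimes>\<^bsub>sal_pi1 \<H> B\<^esub> Y \<otimes>\<^bsub>sal_pi1 \<H> B\<^esub> Z = X \<otimes>\<^bsub>sal_pi1 \<H> B\<^esub> (Y \<otimes>\<^bsub>sal_pi1 \<H> B\<^esub> Z)"
      by (simp add: sal_pi1_mult app)
  next
    fix X Y assume "X \<in> carrier (sal_pi1 \<H> B)" "Y \<in> carrier (sal_pi1 \<H> B)"
    then obtain p q where "sal_path \<H> B p B" "sal_path \<H> B q B" "X = ?c p" "Y = ?c q"
      unfolding car by blast
    then show "X \<otimes>\<^bsub>sal_pi1 \<H> B\<^esub> Y \<in> carrier (sal_pi1 \<H> B)"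
      using app unfolding car by (auto simp only: sal_pi1_mult)
  next
    show "\<one>\<^bsub>sal_pi1 \<H> B\<^esub> \<in> carrier (sal_pi1 \<H> B)"
      unfolding car one using nil by blast
  next
    fix X assume "X \<in> carrier (sal_pi1 \<H> B)"
    then obtain p where p: "sal_path \<H> B p B" "X = ?c p" unfolding car by blast
    then show "\<one>\<^bsub>sal_pi1 \<H> B\<^esub> \<otimes>\<^bsub>sal_pi1 \<H> B\<^esub> X = X"
      using sal_pi1_mult[OF nil p(1)] by (simp add: one)
  qed
qed

section \<open>The pure shard monoid\<close>

definition shard_loop ::
    "'a::euclidean_space set set \<Rightarrow> 'a set \<Rightarrow> 'a set \<Rightarrow> 'a set \<Rightarrow> 'a set step list set" where
  "shard_loop \<H> B C' C =
     homotopy_class \<H> B (gal \<H> B C' @ [Fwd C' C, Fwd C C'] @ path_inverse (gal \<H> B C'))"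

definition pure_shard_monoid ::
    "'a::euclidean_space set set \<Rightarrow> 'a set \<Rightarrow> 'a set step list set set" where
  "pure_shard_monoid \<H> B =
     \<Inter>{M. submonoid M (sal_pi1 \<H> B) \<and> {shard_loop \<H> B C' C | C' C. weak_covers \<H> B C' C} \<subseteq> M}"

definition shard_le ::
    "'a::euclidean_space set set \<Rightarrow> 'a set \<Rightarrow> 'a set step list set \<Rightarrow> 'a set step list set \<Rightarrow> bool" where
  "shard_le \<H> B p p' \<longleftrightarrow> p \<in> pure_shard_monoid \<H> B \<and> p' \<in> pure_shard_monoid \<H> B
     \<and> (\<exists>q\<in>pure_shard_monoid \<H> B. p' = p \<otimes>\<^bsub>sal_pi1 \<H> B\<^esub> q)"

definition full_twist :: "'a::euclidean_space set set \<Rightarrow> 'a set \<Rightarrow> 'a set step list set" where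
  "full_twist \<H> B =
     homotopy_class \<H> B (gal \<H> B (opposite \<H> B) @ gal \<H> (opposite \<H> B) B)"

definition shard_interval ::
    "'a::euclidean_space set set \<Rightarrow> 'a set \<Rightarrow> 'a set step list set \<Rightarrow> 'a set step list set
      \<Rightarrow> 'a set step list set set" where
  "shard_interval \<H> B p q = {r. shard_le \<H> B p r \<and> shard_le \<H> B r q}"

definition self_dual_on :: "'b set \<Rightarrow> ('b \<Rightarrow> 'b \<Rightarrow> bool) \<Rightarrow> bool" where
  "self_dual_on P R \<longleftrightarrow> (\<exists>f. bij_betw f P P \<and> (\<forall>x\<in>P. \<forall>y\<in>P. R x y \<longleftrightarrow> R (f y) (f x)))"

end

(* The duality is x |-> psi(x^{-1} Delta^2) for an involutive anti-automorphism psi of the fundamental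
   group which fixes Delta^2 and permutes the generators. Reversing all paths, together with all the
   directed edges in them, and applying the antipodal map gives an anti-isomorphism onto the group
   based at -B; psi is its conjugate by Delta = gal(B,-B). If e goes from C' to C and f goes from -C to
   -C', then Delta = gal(B,-C) f gal(-C',-B) turns psi(l_e) into l_f.

   All this rests on any two minimal galleries from C to D being homotopic. By induction it suffices
   to compare two first walls, and the first wall met on the way from x in C to a fixed y in D
   minimises a family of linear functionals in x. Along a generic segment in C the first wall changes
   only at points over codimension-2 faces, where the change is a push across a 2-cell. *)

theory Submission
  imports Defs
begin

section \<open>Regions and separating hyperplanes\<close>

text \<open>The map x |-> x^{-1} Delta^2 alone exchanges left divisors with right divisors and
  reverses the order; an anti-automorphism is what turns right division back into left division.

  Reversing paths and edges without the antipodal map would already fix B, but it sends l_e to a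
  loop that approaches the wall along edges traversed backwards, and this is not visibly a
  generator. With the antipodal map the access path becomes the end of a minimal gallery from B to
  -B, and conjugation by Delta absorbs it.

  For minimal galleries the obstacle is that a single 2-cell relates only first walls around a
  common codimension-2 face, so two arbitrary first walls need a chain of intermediate ones. Moving
  the starting point through C with y fixed supplies this chain: each wall that separates C from D
  is met first from some nonempty open set of points of C, and C is convex.\<close>

definition normal_of :: "'a::euclidean_space set \<Rightarrow> 'a" where
  "normal_of h = (SOME a. normal_to a h)"

text \<open>One point with a positive value fixes the sign, since a region lies on one side of each
  hyperplane (\<open>mem_region\<close>).\<close>

definition inward :: "'a::euclidean_space set \<Rightarrow> 'a set \<Rightarrow> 'a" where
  "inward C h = (if \<exists>x\<in>C. 0 < normal_of h \<bullet> x then normal_of h else - normal_of h)"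

text \<open>Hyperplanes have empty interior. Intersecting \<open>U\<close> with the complement of
  one hyperplane at a time keeps it open and nonempty, as the induction requires. All generic
  choices below come from here.\<close>

lemma open_avoids_hyperplanes:
  fixes U :: "'a::euclidean_space set"
  assumes "finite V" "open U" "U \<noteq> {}" "0 \<notin> V"
  obtains x where "x \<in> U" "\<And>v. v \<in> V \<Longrightarrow> v \<bullet> x \<noteq> 0"
proof -
  have "\<exists>x\<in>U. \<forall>v\<in>V. v \<bullet> x \<noteq> 0"
    using assms
  proof (induction V arbitrary: U rule: finite_induct)
    case (insert v V)
    have "U \<inter> {x. v \<bullet> x \<noteq> 0} \<noteq> {}"
    proof
      assume "U \<inter> {x. v \<bullet> x \<noteq> 0} = {}"
      then have "U \<subseteq> interior {x. v \<bullet> x = 0}"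
        using insert.prems by (intro interior_maximal) auto
      then show False using insert.prems by (auto simp: interior_hyperplane)
    qed
    moreover have "open (U \<inter> {x. v \<bullet> x \<noteq> 0})"
      using insert.prems by (intro open_Int open_Collect_neq continuous_intros)
    ultimately have "\<exists>x\<in>U \<inter> {x. v \<bullet> x \<noteq> 0}. \<forall>w\<in>V. w \<bullet> x \<noteq> 0"
      using insert.prems by (intro insert.IH) auto
    then show ?case by auto
  qed auto
  with that show ?thesis by blast
qed

lemma dim_orthogonal_pair:
  fixes a b :: "'a::euclidean_space"
  assumes "independent {a, b}" "a \<noteq> b"
  shows "dim {v. a \<bullet> v = 0 \<and> b \<bullet> v = 0} + 2 = DIM('a)"
proof -
  have "dim {v \<in> UNIV. \<forall>u \<in> span {a, b}. orthogonal u v} + dim (span {a, b}) = dim (UNIV :: 'a set)"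
    by (rule dim_subspace_orthogonal_to_vectors) auto
  moreover have "dim (span {a, b}) = 2"
    using assms dim_eq_card_independent[of "{a, b}"] by simp
  moreover have "(\<forall>u \<in> span {a, b}. orthogonal u v) \<longleftrightarrow> a \<bullet> v = 0 \<and> b \<bullet> v = 0" for v
  proof
    assume "\<forall>u \<in> span {a, b}. orthogonal u v"
    then show "a \<bullet> v = 0 \<and> b \<bullet> v = 0"
      by (simp add: orthogonal_def span_base)
  next
    assume "a \<bullet> v = 0 \<and> b \<bullet> v = 0"
    then have "orthogonal v u" if "u \<in> span {a, b}" for u
      by (intro orthogonal_to_span[OF that]) (auto simp: orthogonal_def inner_commute)
    then show "\<forall>u \<in> span {a, b}. orthogonal u v" by (simp add: orthogonal_commute)
  qed
  ultimately show ?thesis by (simp add: dim_UNIV)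
qed

lemma eventually_small_pos:
  fixes a b :: real
  assumes "0 < a"
  shows "eventually (\<lambda>e. 0 < a + e * b) (at_right 0)"
proof -
  have "((\<lambda>e. a + e * b) \<longlongrightarrow> a + 0 * b) (at_right 0)" by (intro tendsto_intros)
  then show ?thesis using assms by (intro order_tendstoD(1)) auto
qed

locale arrangement =
  fixes H :: "'a::euclidean_space set set"
  assumes central: "central_arrangement H"
begin

lemma finite_H: "finite H"
  using central by (simp add: central_arrangement_def)

lemma normal_of: "h \<in> H \<Longrightarrow> normal_to (normal_of h) h"
  using central unfolding central_arrangement_def normal_of_def by (metis someI_ex)

lemma inward_normal: "h \<in> H \<Longrightarrow> normal_to (inward C h) h"
  using normal_of[of h] by (auto simp: normal_to_def inward_def)

lemma region_nonempty: "C \<in> regions H \<Longrightarrow> C \<noteq> {}"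
  unfolding regions_def by (rule in_components_nonempty)

text \<open>By connectedness each normal has constant sign on a component. Conversely, the cone cut
  out by these signs is convex, hence connected, misses every hyperplane and meets \<open>C\<close>,
  so maximality of components puts it inside \<open>C\<close>.\<close>

lemma mem_region:
  assumes C: "C \<in> regions H"
  shows "x \<in> C \<longleftrightarrow> (\<forall>h\<in>H. 0 < inward C h \<bullet> x)"
proof -
  have pos: "0 < inward C h \<bullet> x" if x: "x \<in> C" and h: "h \<in> H" for x h
  proof -
    have sub: "C \<subseteq> UNIV - \<Union>H" and conn: "connected C"
      using C in_components_subset in_components_connected unfolding regions_def by blast+
    have nz: "normal_of h \<bullet> y \<noteq> 0" if "y \<in> C" for y
      using normal_of[OF h] sub that h by (auto simp: normal_to_def)
    have "\<not> (normal_of h \<bullet> y < 0 \<and> 0 < normal_of h \<bullet> z)" if "y \<in> C" "z \<in> C" for y z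
      using connected_ivt_hyperplane[OF conn that, of "normal_of h" 0] nz by force
    then show ?thesis
      using nz[OF x] x unfolding inward_def
      by (cases "0 < normal_of h \<bullet> x") (force simp: not_less)+
  qed
  define K where "K = {x. \<forall>h\<in>H. 0 < inward C h \<bullet> x}"
  have "C \<subseteq> K" using pos by (auto simp: K_def)
  have K: "K = (\<Inter>h\<in>H. {x. 0 < inward C h \<bullet> x})" by (auto simp: K_def)
  have "convex K"
    unfolding K by (intro convex_INT convex_halfspace_gt)
  moreover have "K \<subseteq> UNIV - \<Union>H"
  proof
    fix x assume x: "x \<in> K"
    have "x \<notin> h" if "h \<in> H" for h
      using inward_normal[OF that, of C] x that by (force simp: K_def normal_to_def)
    then show "x \<in> UNIV - \<Union>H" by blast
  qed
  ultimately have "K \<subseteq> C"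
    using components_maximal[of C "UNIV - \<Union>H" K] C \<open>C \<subseteq> K\<close> region_nonempty[OF C]
    by (auto simp: regions_def convex_connected)
  with \<open>C \<subseteq> K\<close> show ?thesis by (auto simp: K_def)
qed

lemma region_of_point:
  assumes "\<And>h. h \<in> H \<Longrightarrow> normal_of h \<bullet> x \<noteq> 0"
  obtains C where "C \<in> regions H" "x \<in> C"
proof -
  have "x \<in> UNIV - \<Union>H"
    using assms normal_of unfolding normal_to_def by blast
  then show ?thesis
    using that Union_components[of "UNIV - \<Union>H"] unfolding regions_def by blast
qed

lemma region_open: "C \<in> regions H \<Longrightarrow> open C"
proof -
  assume "C \<in> regions H"
  then have "C = (\<Inter>h\<in>H. {x. 0 < inward C h \<bullet> x})" using mem_region by blast
  moreover have "open (\<Inter>h\<in>H. {x. 0 < inward C h \<bullet> x})"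
    using finite_H by (intro open_INT) (auto simp: open_halfspace_gt)
  ultimately show ?thesis by simp
qed

lemma region_convex: "C \<in> regions H \<Longrightarrow> convex C"
proof -
  assume "C \<in> regions H"
  then have "C = (\<Inter>h\<in>H. {x. 0 < inward C h \<bullet> x})" using mem_region by blast
  moreover have "convex (\<Inter>h\<in>H. {x. 0 < inward C h \<bullet> x})"
    by (intro convex_INT convex_halfspace_gt)
  ultimately show ?thesis by simp
qed

lemma inward_cases: "inward D h = inward C h \<or> inward D h = - inward C h"
  by (auto simp: inward_def)

text \<open>Separation quantifies over all points of both regions; this reduces it to one sign at an
  arbitrary sample point of \<open>D\<close>.\<close>

lemma mem_inversions:
  assumes C: "C \<in> regions H" and D: "D \<in> regions H" and y: "y \<in> D"
  shows "h \<in> inversions H C D \<longleftrightarrow> h \<in> H \<and> inward C h \<bullet> y < 0"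
proof (cases "h \<in> H")
  case h: True
  have n: "normal_to (inward C h) h" by (rule inward_normal[OF h])
  obtain x where x: "x \<in> C" using region_nonempty[OF C] by blast
  have xp: "0 < inward C h \<bullet> x" using mem_region[OF C] x h by blast
  show ?thesis
  proof
    assume "h \<in> inversions H C D"
    then obtain a where a: "normal_to a h" "a \<bullet> x < 0" "0 < a \<bullet> y"
      using x y by (auto simp: inversions_def separates_def)
    \<comment> \<open>A separating functional vanishes somewhere between \<open>x\<close> and
      \<open>y\<close>. Its zero set is \<open>h\<close>, so \<open>inward C h\<close> vanishes
      there too and cannot be positive at both ends.\<close>
    then obtain z where z: "z \<in> closed_segment x y" "a \<bullet> z = 0"
      using connected_ivt_hyperplane[of "closed_segment x y" x y a 0] by auto
    have "inward C h \<bullet> z = 0" using z(2) a(1) n by (auto simp: normal_to_def)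
    moreover obtain u where u: "0 \<le> u" "u \<le> 1" "z = (1 - u) *\<^sub>R x + u *\<^sub>R y"
      using z(1) by (auto simp: closed_segment_def)
    moreover have "y \<notin> h" using a by (auto simp: normal_to_def)
    then have "inward C h \<bullet> y \<noteq> 0" using n by (auto simp: normal_to_def)
    ultimately have e: "(1 - u) * (inward C h \<bullet> x) + u * (inward C h \<bullet> y) = 0"
      by (simp add: inner_add_right)
    have "inward C h \<bullet> y < 0"
    proof (rule ccontr)
      assume "\<not> ?thesis"
      with \<open>inward C h \<bullet> y \<noteq> 0\<close> have "0 < inward C h \<bullet> y" by simp
      then have "0 < (1 - u) * (inward C h \<bullet> x) + u * (inward C h \<bullet> y)"
        using xp u(1,2) by (cases "u = 0") (auto intro!: add_nonneg_pos)
      then show False using e by simp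
    qed
    with h show "h \<in> H \<and> inward C h \<bullet> y < 0" by simp
  next
    assume r: "h \<in> H \<and> inward C h \<bullet> y < 0"
    moreover have "0 < inward D h \<bullet> y" using mem_region[OF D] y h by blast
    ultimately have "inward D h = - inward C h" using inward_cases[of D h C] by auto
    then have "separates h C D"
      unfolding separates_def using mem_region[OF D] mem_region[OF C] h inward_normal[OF h, of D]
      by (metis inner_minus_left neg_less_0_iff_less)
    with h show "h \<in> inversions H C D" by (simp add: inversions_def)
  qed
qed (auto simp: inversions_def)

section \<open>Calculus of inversion sets\<close>

lemma inward_inversions:
  assumes "C \<in> regions H" "D \<in> regions H" "h \<in> H"
  shows "inward D h = (if h \<in> inversions H C D then - inward C h else inward C h)"
proof -
  obtain y where y: "y \<in> D" using region_nonempty[OF assms(2)] by blast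
  then have "0 < inward D h \<bullet> y" using mem_region[OF assms(2)] assms(3) by blast
  with mem_inversions[OF assms(1,2) y, of h] assms(3) inward_cases[of D h C]
  show ?thesis by auto
qed

lemma inward_nonzero: "h \<in> H \<Longrightarrow> inward C h \<noteq> 0"
  using inward_normal[of h C] by (simp add: normal_to_def)

lemma inward_neg_neq: "h \<in> H \<Longrightarrow> - inward C h \<noteq> inward C h"
  using inward_nonzero[of h C] by (metis add.right_inverse scaleR_2 scaleR_eq_0_iff zero_neq_numeral)

lemma inversions_subset: "inversions H C D \<subseteq> H"
  by (auto simp: inversions_def)

lemma finite_inversions: "finite (inversions H C D)"
  using inversions_subset finite_H by (rule finite_subset)

text \<open>Signs multiply: from \<open>C\<close> to \<open>D\<close> and on to \<open>E\<close>,
  the inward normal of \<open>h\<close> is negated once for each of the two inversion sets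
  containing \<open>h\<close>, and a nonzero vector differs from its negative.\<close>

lemma inversions_sym_diff:
  assumes "C \<in> regions H" "D \<in> regions H" "E \<in> regions H"
  shows "inversions H C E =
    (inversions H C D - inversions H D E) \<union> (inversions H D E - inversions H C D)"
proof (rule Set.set_eqI)
  fix h
  show "h \<in> inversions H C E \<longleftrightarrow> h \<in> (inversions H C D - inversions H D E)
    \<union> (inversions H D E - inversions H C D)"
  proof (cases "h \<in> H")
    case True
    then show ?thesis
      using inward_inversions[OF assms(1,2) True] inward_inversions[OF assms(2,3) True]
        inward_inversions[OF assms(1,3) True] inward_neg_neq[OF True, of C]
      by (auto split: if_splits)
  next
    case False
    then show ?thesis using inversions_subset by blast
  qed
qed

lemma inversions_same: "C \<in> regions H \<Longrightarrow> inversions H C C = {}"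
  using inversions_sym_diff[of C C C] by blast

lemma inversions_empty_iff:
  assumes "C \<in> regions H" "D \<in> regions H"
  shows "inversions H C D = {} \<longleftrightarrow> C = D"
proof
  assume "inversions H C D = {}"
  then have "\<And>h. h \<in> H \<Longrightarrow> inward D h = inward C h"
    using inward_inversions[OF assms] by simp
  then show "C = D" using mem_region[OF assms(1)] mem_region[OF assms(2)] by (metis subsetI subset_antisym)
qed (use assms inversions_same in simp)

lemma inversions_commute:
  assumes "C \<in> regions H" "D \<in> regions H"
  shows "inversions H C D = inversions H D C"
  using inversions_sym_diff[of C D C] inversions_same assms by auto

lemma inversions_inject:
  assumes "C \<in> regions H" "D \<in> regions H" "E \<in> regions H" "inversions H C D = inversions H C E"
  shows "D = E"
  using inversions_sym_diff[of D C E] inversions_commute[of C D] assms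
    inversions_empty_iff[of D E] by auto

text \<open>New regions are produced below by exhibiting a point of them; its signs give the
  inversion set.\<close>

lemma region_with_inversions:
  assumes C: "C \<in> regions H" and nz: "\<And>h. h \<in> H \<Longrightarrow> inward C h \<bullet> z \<noteq> 0"
  obtains D where "D \<in> regions H" "z \<in> D" "inversions H C D = {h\<in>H. inward C h \<bullet> z < 0}"
proof -
  have "normal_of h \<bullet> z \<noteq> 0" if "h \<in> H" for h
    using nz[OF that] by (auto simp: inward_def split: if_splits)
  then obtain D where "D \<in> regions H" "z \<in> D" by (rule region_of_point)
  with mem_inversions[OF C] that show ?thesis by blast
qed

section \<open>Minimal galleries\<close>

lemma adjacent_iff:
  "adjacent H C D \<longleftrightarrow> C \<in> regions H \<and> D \<in> regions H \<and> (\<exists>h. inversions H C D = {h})"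
  by (auto simp: adjacent_def card_1_singleton_iff)

lemma positive_gallery_Nil: "positive_gallery H C [] D \<longleftrightarrow> C \<in> regions H \<and> C = D"
  by (auto simp: positive_gallery_def)

lemma positive_gallery_Cons:
  "positive_gallery H C (s # g) D \<longleftrightarrow>
     (\<exists>E. s = Fwd C E \<and> adjacent H C E \<and> positive_gallery H E g D)"
  by (cases s) (auto simp: positive_gallery_def)

lemma positive_gallery_regions:
  "positive_gallery H C g D \<Longrightarrow> C \<in> regions H \<and> D \<in> regions H"
  using sal_path_source sal_path_target by (auto simp: positive_gallery_def)

lemma inversions_step:
  assumes "C \<in> regions H" "E \<in> regions H" "D \<in> regions H" "inversions H C E = {h}"
  shows "inversions H E D =
    (if h \<in> inversions H C D then inversions H C D - {h} else insert h (inversions H C D))"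
  using inversions_sym_diff[of C E D] assms by auto

lemma card_inversions_le: "positive_gallery H C g D \<Longrightarrow> card (inversions H C D) \<le> length g"
proof (induction g arbitrary: C)
  case Nil
  then show ?case by (auto simp: positive_gallery_Nil inversions_same)
next
  case (Cons s g)
  then obtain E h where E: "C \<in> regions H" "E \<in> regions H" "inversions H C E = {h}"
      "positive_gallery H E g D"
    by (auto simp: positive_gallery_Cons adjacent_iff)
  then have "D \<in> regions H" using positive_gallery_regions by blast
  then have "inversions H C D \<subseteq> insert h (inversions H E D)"
    using inversions_step[OF E(1,2) _ E(3)] by auto
  then have "card (inversions H C D) \<le> card (insert h (inversions H E D))"
    by (intro card_mono) (simp_all add: finite_inversions)
  also have "\<dots> \<le> Suc (card (inversions H E D))"
    by (simp add: card_insert_if finite_inversions)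
  finally show ?case using Cons.IH[OF E(4)] by simp
qed

lemma minimal_gallery_Nil: "minimal_gallery H C [] D \<longleftrightarrow> C \<in> regions H \<and> C = D"
  by (auto simp: minimal_gallery_def positive_gallery_Nil inversions_same)

text \<open>Crossing a hyperplane that does not separate \<open>C\<close> from \<open>D\<close>
  leaves one more to cross than before, while \<open>card_inversions_le\<close> bounds the rest of
  the gallery from below. Later inductions use this recursion in place of the length
  condition.\<close>

lemma minimal_gallery_Cons:
  "minimal_gallery H C (s # g) D \<longleftrightarrow>
     (\<exists>E h. s = Fwd C E \<and> C \<in> regions H \<and> E \<in> regions H \<and> inversions H C E = {h}
        \<and> h \<in> inversions H C D \<and> minimal_gallery H E g D)"
  (is "?l \<longleftrightarrow> ?r")
proof
  assume l: ?l
  then obtain E h where E: "s = Fwd C E" "C \<in> regions H" "E \<in> regions H" "inversions H C E = {h}"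
      "positive_gallery H E g D"
    by (auto simp: minimal_gallery_def positive_gallery_Cons adjacent_iff)
  have D: "D \<in> regions H" using E positive_gallery_regions by blast
  have len: "length g + 1 = card (inversions H C D)" using l by (simp add: minimal_gallery_def)
  have h: "h \<in> inversions H C D"
  proof (rule ccontr)
    assume n: "h \<notin> inversions H C D"
    then have "card (inversions H E D) = Suc (card (inversions H C D))"
      using inversions_step[OF E(2,3) D E(4)] by (simp add: finite_inversions)
    then show False using card_inversions_le[OF E(5)] len by simp
  qed
  then have "card (inversions H E D) = length g"
    using inversions_step[OF E(2,3) D E(4)] len by (simp add: finite_inversions)
  with E h show ?r by (auto simp: minimal_gallery_def)
next
  assume ?r
  then obtain E h where E: "s = Fwd C E" "C \<in> regions H" "E \<in> regions H" "inversions H C E = {h}"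
      "h \<in> inversions H C D" "minimal_gallery H E g D" by blast
  then have D: "D \<in> regions H" using positive_gallery_regions by (auto simp: minimal_gallery_def)
  have "card (inversions H C D) = Suc (card (inversions H E D))"
    using inversions_step[OF E(2,3) D E(4)] E(5) card.remove[OF finite_inversions E(5)] by simp
  then show ?l using E by (auto simp: minimal_gallery_def positive_gallery_Cons adjacent_iff)
qed

lemma minimal_gallery_regions:
  "minimal_gallery H C g D \<Longrightarrow> C \<in> regions H \<and> D \<in> regions H"
  by (auto simp: minimal_gallery_def dest: positive_gallery_regions)

lemma minimal_gallery_path: "minimal_gallery H C g D \<Longrightarrow> sal_path H C g D"
  by (simp add: minimal_gallery_def positive_gallery_def)

text \<open>With disjoint inversion sets nothing is crossed twice, so the numbers of separating
  hyperplanes add up as the lengths do.\<close>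

lemma minimal_gallery_append:
  assumes "minimal_gallery H C g E" "minimal_gallery H E g' D"
    and "inversions H C E \<inter> inversions H E D = {}"
  shows "minimal_gallery H C (g @ g') D"
proof -
  have "inversions H C D = inversions H C E \<union> inversions H E D"
    using inversions_sym_diff[of C E D] assms minimal_gallery_regions by blast
  then have "card (inversions H C D) = card (inversions H C E) + card (inversions H E D)"
    using assms(3) by (simp add: card_Un_disjoint finite_inversions)
  then show ?thesis
    using assms by (auto simp: minimal_gallery_def positive_gallery_def sal_path_append)
qed

text \<open>This keeps a gallery from \<open>C\<close> to the region opposite it about a face among
  the regions around that face.\<close>

lemma minimal_gallery_between:
  assumes "minimal_gallery H C g D" "s \<in> set g"
  shows "step_source s \<in> regions H \<and> step_target s \<in> regions H
    \<and> inversions H C (step_source s) \<subseteq> inversions H C D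
    \<and> inversions H C (step_target s) \<subseteq> inversions H C D"
  using assms
proof (induction g arbitrary: C)
  case (Cons t g)
  then obtain E h where E: "t = Fwd C E" "C \<in> regions H" "E \<in> regions H" "inversions H C E = {h}"
      "h \<in> inversions H C D" "minimal_gallery H E g D" by (auto simp: minimal_gallery_Cons)
  show ?case
  proof (cases "s = t")
    case True
    then show ?thesis using E inversions_same by auto
  next
    case False
    have D: "D \<in> regions H" using E minimal_gallery_regions by blast
    have "inversions H C X \<subseteq> inversions H C D"
      if "X \<in> regions H" "inversions H E X \<subseteq> inversions H E D" for X
      using inversions_step[OF E(2,3) that(1) E(4)] inversions_step[OF E(2,3) D E(4)] that(2) E(5)
      by (auto split: if_splits)
    then show ?thesis using Cons.IH[OF E(6)] Cons.prems False by auto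
  qed
qed simp

text \<open>For \<open>x \<in> C\<close> and a hyperplane \<open>h\<close> separating \<open>C\<close> from \<open>y\<close>, the ray from \<open>x\<close> in direction \<open>y\<close>
  (which meets the same regions as the segment from \<open>x\<close> to \<open>y\<close>) crosses \<open>h\<close> at the parameter
  \<open>scaled C y h \<bullet> x\<close>, which is linear in \<open>x\<close>.\<close>

definition scaled :: "'a set \<Rightarrow> 'a \<Rightarrow> 'a set \<Rightarrow> 'a" where
  "scaled C y h = (- 1 / (inward C h \<bullet> y)) *\<^sub>R inward C h"

lemma scaled_inner: "inward C h \<bullet> y < 0 \<Longrightarrow> inward C h \<bullet> v = - (inward C h \<bullet> y) * (scaled C y h \<bullet> v)"
  by (simp add: scaled_def)

lemma scaled_eq_0_iff: "inward C h \<bullet> y < 0 \<Longrightarrow> scaled C y h \<bullet> v = 0 \<longleftrightarrow> inward C h \<bullet> v = 0"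
  by (simp add: scaled_def)

lemma scaled_self: "inward C h \<bullet> y < 0 \<Longrightarrow> scaled C y h \<bullet> y = - 1"
  by (simp add: scaled_def)

lemma scaled_pos_iff: "inward C h \<bullet> y < 0 \<Longrightarrow> 0 < scaled C y h \<bullet> v \<longleftrightarrow> 0 < inward C h \<bullet> v"
  by (auto simp: scaled_def divide_less_0_iff)

lemma scaled_nonneg_iff: "inward C h \<bullet> y < 0 \<Longrightarrow> 0 \<le> scaled C y h \<bullet> v \<longleftrightarrow> 0 \<le> inward C h \<bullet> v"
  by (auto simp: scaled_def divide_le_0_iff)

lemma scaled_pos:
  assumes "C \<in> regions H" "h \<in> H" "inward C h \<bullet> y < 0" "x \<in> C"
  shows "0 < scaled C y h \<bullet> x"
  using mem_region[OF assms(1)] assms by (simp add: scaled_pos_iff)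

lemma scaled_inject:
  assumes "h \<in> H" "j \<in> H" "inward C h \<bullet> y < 0" "inward C j \<bullet> y < 0" "scaled C y h = scaled C y j"
  shows "h = j"
proof -
  have h: "h = {v. inward C h \<bullet> v = 0}" and j: "j = {v. inward C j \<bullet> v = 0}"
    using inward_normal assms(1,2) unfolding normal_to_def by blast+
  have "{v. inward C h \<bullet> v = 0} = {v. inward C j \<bullet> v = 0}"
    using scaled_eq_0_iff[OF assms(3)] scaled_eq_0_iff[OF assms(4)] assms(5) by simp
  with h j show ?thesis by metis
qed

text \<open>For separating \<open>h\<close> the value at \<open>x + m *\<^sub>R y\<close> is
  \<open>- (inward C h \<bullet> y) * (scaled C y h \<bullet> x - m)\<close>, whose first factor is
  positive. For the other hyperplanes \<open>inward C h \<bullet> y\<close> is nonnegative, so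
  moving along \<open>y\<close> cannot destroy positivity.\<close>

lemma touching_point:
  assumes C: "C \<in> regions H" and D: "D \<in> regions H" and y: "y \<in> D" and x: "x \<in> C"
    and m: "0 < m" "\<And>j. j \<in> inversions H C D \<Longrightarrow> m \<le> scaled C y j \<bullet> x"
    and h: "h \<in> H"
  shows "if h \<in> inversions H C D \<and> scaled C y h \<bullet> x = m then inward C h \<bullet> (x + m *\<^sub>R y) = 0
    else 0 < inward C h \<bullet> (x + m *\<^sub>R y)"
proof (cases "h \<in> inversions H C D")
  case True
  then have n: "inward C h \<bullet> y < 0" using mem_inversions[OF C D y] by blast
  have e: "inward C h \<bullet> (x + m *\<^sub>R y) = - (inward C h \<bullet> y) * (scaled C y h \<bullet> x - m)"
    using scaled_inner[OF n, of x] by (simp add: algebra_simps inner_add_right)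
  show ?thesis using True m(2)[OF True] n by (auto simp: e intro!: mult_pos_pos mult_neg_pos)
next
  case False
  then have "0 \<le> inward C h \<bullet> y" using mem_inversions[OF C D y] h by force
  moreover have "0 < inward C h \<bullet> x" using mem_region[OF C] x h by blast
  ultimately show ?thesis using False m(1) by (simp add: inner_add_right add_pos_nonneg)
qed

text \<open>A small step from \<open>z\<close> against a point \<open>x\<close> of \<open>C\<close>
  makes the functionals vanishing at \<open>z\<close> negative and leaves the positive ones
  positive. The result is the region opposite \<open>C\<close> about the face through
  \<open>z\<close>.\<close>

lemma region_beyond:
  assumes C: "C \<in> regions H" and z: "\<And>h. h \<in> H \<Longrightarrow> 0 \<le> inward C h \<bullet> z"
  obtains E where "E \<in> regions H" "inversions H C E = {h\<in>H. inward C h \<bullet> z = 0}"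
proof -
  obtain x where x: "x \<in> C" using region_nonempty[OF C] by blast
  have xp: "0 < inward C h \<bullet> x" if "h \<in> H" for h using mem_region[OF C] x that by blast
  have ev: "eventually (\<lambda>e. if inward C h \<bullet> z = 0 then inward C h \<bullet> (z - e *\<^sub>R x) < 0
      else 0 < inward C h \<bullet> (z - e *\<^sub>R x)) (at_right 0)" if "h \<in> H" for h
  proof (cases "inward C h \<bullet> z = 0")
    case True
    have "eventually (\<lambda>e::real. 0 < e) (at_right 0)" by (rule eventually_at_right_less)
    then show ?thesis
      by (rule eventually_mono) (use True xp[OF that] in \<open>simp add: inner_diff_right\<close>)
  next
    case False
    then have "0 < inward C h \<bullet> z" using z[OF that] by simp
    from eventually_small_pos[OF this, of "- (inward C h \<bullet> x)"] show ?thesis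
      by (rule eventually_mono) (use False in \<open>simp add: inner_diff_right\<close>)
  qed
  have "eventually (\<lambda>e. \<forall>h\<in>H. if inward C h \<bullet> z = 0 then inward C h \<bullet> (z - e *\<^sub>R x) < 0
      else 0 < inward C h \<bullet> (z - e *\<^sub>R x)) (at_right 0)"
    using ev finite_H by (intro eventually_ball_finite) auto
  then have "\<exists>e. \<forall>h\<in>H. if inward C h \<bullet> z = 0 then inward C h \<bullet> (z - e *\<^sub>R x) < 0
      else 0 < inward C h \<bullet> (z - e *\<^sub>R x)"
    by (rule eventually_happens'[OF trivial_limit_at_right_real])
  then obtain e where e: "\<And>h. h \<in> H \<Longrightarrow> if inward C h \<bullet> z = 0
      then inward C h \<bullet> (z - e *\<^sub>R x) < 0 else 0 < inward C h \<bullet> (z - e *\<^sub>R x)"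
    by blast
  obtain E where "E \<in> regions H" "inversions H C E = {h\<in>H. inward C h \<bullet> (z - e *\<^sub>R x) < 0}"
  proof (rule region_with_inversions[OF C, of "z - e *\<^sub>R x"])
    show "inward C h \<bullet> (z - e *\<^sub>R x) \<noteq> 0" if "h \<in> H" for h
      using e[OF that] by (auto split: if_splits)
  qed
  moreover have "{h\<in>H. inward C h \<bullet> (z - e *\<^sub>R x) < 0} = {h\<in>H. inward C h \<bullet> z = 0}"
    using e by (force split: if_splits)
  ultimately show ?thesis using that by simp
qed

lemma generic_argmin:
  assumes C: "C \<in> regions H" and D: "D \<in> regions H" "C \<noteq> D"
    and inj: "inj_on (\<lambda>h. scaled C y h \<bullet> x) (inversions H C D)"
  obtains h where "h \<in> inversions H C D"
    "\<And>j. j \<in> inversions H C D \<Longrightarrow> j \<noteq> h \<Longrightarrow> scaled C y h \<bullet> x < scaled C y j \<bullet> x"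
proof -
  have ne: "inversions H C D \<noteq> {}" using inversions_empty_iff C D by blast
  define h where "h = arg_min_on (\<lambda>h. scaled C y h \<bullet> x) (inversions H C D)"
  have h: "h \<in> inversions H C D"
    unfolding h_def using finite_inversions ne by (rule arg_min_if_finite)
  have "scaled C y h \<bullet> x \<le> scaled C y j \<bullet> x" if "j \<in> inversions H C D" for j
    unfolding h_def using finite_inversions ne that by (rule arg_min_least)
  then show ?thesis
    using that[OF h] inj h by (metis inj_onD order_le_less)
qed

lemma scaled_differences:
  assumes "C \<in> regions H" "D \<in> regions H" "y \<in> D"
    "h \<in> inversions H C D" "j \<in> inversions H C D" "h \<noteq> j"
  shows "scaled C y h - scaled C y j \<noteq> 0"
  using scaled_inject[of h j C y] mem_inversions[OF assms(1-3)] assms(4-6) by auto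

lemma generic_point:
  assumes "C \<in> regions H" "D \<in> regions H" "y \<in> D" "open U" "U \<noteq> {}"
  obtains x where "x \<in> U" "\<And>h j. h \<in> inversions H C D \<Longrightarrow> j \<in> inversions H C D \<Longrightarrow> h \<noteq> j \<Longrightarrow>
    (scaled C y h - scaled C y j) \<bullet> x \<noteq> 0"
proof -
  let ?S = "inversions H C D"
  let ?V = "(\<lambda>(h, j). scaled C y h - scaled C y j) ` ({p. fst p \<noteq> snd p} \<inter> (?S \<times> ?S))"
  have "finite ?V" by (simp add: finite_inversions)
  moreover have "0 \<notin> ?V" using scaled_differences[OF assms(1-3)] by force
  ultimately obtain x where x: "x \<in> U" "\<And>v. v \<in> ?V \<Longrightarrow> v \<bullet> x \<noteq> 0"
    using open_avoids_hyperplanes[of ?V U] assms(4,5) by blast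
  show ?thesis
    by (rule that[OF x(1)], rule x(2)) force
qed

text \<open>\<open>h\<close> is the unique first hyperplane met from \<open>x\<close>. Strictness
  makes this an open condition on \<open>x\<close>, so sample points can be moved into generic
  position.\<close>

definition nearest :: "'a set \<Rightarrow> 'a set \<Rightarrow> 'a \<Rightarrow> 'a set \<Rightarrow> 'a \<Rightarrow> bool" where
  "nearest C D y h x \<longleftrightarrow> x \<in> C \<and> h \<in> inversions H C D
     \<and> (\<forall>j\<in>inversions H C D. j \<noteq> h \<longrightarrow> scaled C y h \<bullet> x < scaled C y j \<bullet> x)"

text \<open>At the first crossing time only the functional of \<open>h\<close> vanishes, so
  \<open>region_beyond\<close> crosses \<open>h\<close> alone.\<close>

lemma step_of_nearest:
  assumes C: "C \<in> regions H" and D: "D \<in> regions H" and y: "y \<in> D" and n: "nearest C D y h x"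
  obtains E where "E \<in> regions H" "inversions H C E = {h}"
proof -
  have x: "x \<in> C" and h: "h \<in> inversions H C D"
      "\<And>j. j \<in> inversions H C D \<Longrightarrow> j \<noteq> h \<Longrightarrow> scaled C y h \<bullet> x < scaled C y j \<bullet> x"
    using n by (auto simp: nearest_def)
  define m where "m = scaled C y h \<bullet> x"
  have m: "0 < m" "\<And>j. j \<in> inversions H C D \<Longrightarrow> m \<le> scaled C y j \<bullet> x"
    using h scaled_pos[OF C _ _ x] mem_inversions[OF C D y] less_imp_le unfolding m_def by blast+
  have t: "if j \<in> inversions H C D \<and> scaled C y j \<bullet> x = m then inward C j \<bullet> (x + m *\<^sub>R y) = 0
    else 0 < inward C j \<bullet> (x + m *\<^sub>R y)" if "j \<in> H" for j
    by (rule touching_point[OF C D y x m(1) _ that]) (rule m(2))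
  have "0 \<le> inward C j \<bullet> (x + m *\<^sub>R y)" if "j \<in> H" for j
    using t[OF that] by (auto split: if_splits)
  then obtain E where "E \<in> regions H"
      "inversions H C E = {j\<in>H. inward C j \<bullet> (x + m *\<^sub>R y) = 0}"
    by (rule region_beyond[OF C])
  moreover have "{j\<in>H. inward C j \<bullet> (x + m *\<^sub>R y) = 0} = {h}"
  proof
    show "{j\<in>H. inward C j \<bullet> (x + m *\<^sub>R y) = 0} \<subseteq> {h}"
    proof
      fix j assume j: "j \<in> {j\<in>H. inward C j \<bullet> (x + m *\<^sub>R y) = 0}"
      then have "j \<in> inversions H C D \<and> scaled C y j \<bullet> x = m"
        using t[of j] by (auto split: if_splits)
      then show "j \<in> {h}" using h(2)[of j] by (auto simp: m_def)
    qed
    show "{h} \<subseteq> {j\<in>H. inward C j \<bullet> (x + m *\<^sub>R y) = 0}"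
      using t[of h] h(1) inversions_subset by (auto simp: m_def)
  qed
  ultimately show ?thesis using that by simp
qed

text \<open>For generic \<open>x\<close> no two crossing times agree, so some hyperplane is met
  strictly first and is a wall of \<open>C\<close>.\<close>

lemma first_step_exists:
  assumes C: "C \<in> regions H" and D: "D \<in> regions H" and ne: "C \<noteq> D"
  obtains E h where "E \<in> regions H" "inversions H C E = {h}" "h \<in> inversions H C D"
proof -
  obtain y where y: "y \<in> D" using region_nonempty[OF D] by blast
  obtain x where x: "x \<in> C" "\<And>h j. h \<in> inversions H C D \<Longrightarrow> j \<in> inversions H C D \<Longrightarrow> h \<noteq> j \<Longrightarrow>
      (scaled C y h - scaled C y j) \<bullet> x \<noteq> 0"
    using generic_point[OF C D y region_open[OF C] region_nonempty[OF C]] by blast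
  then have "inj_on (\<lambda>h. scaled C y h \<bullet> x) (inversions H C D)"
    by (intro inj_onI) (force simp: inner_diff_left)
  then obtain h where h: "h \<in> inversions H C D"
      "\<And>j. j \<in> inversions H C D \<Longrightarrow> j \<noteq> h \<Longrightarrow> scaled C y h \<bullet> x < scaled C y j \<bullet> x"
    using generic_argmin[OF C D ne] by blast
  with x(1) have "nearest C D y h x" by (simp add: nearest_def)
  with step_of_nearest[OF C D y] that h(1) show ?thesis by blast
qed

lemma minimal_gallery_exists:
  assumes "C \<in> regions H" "D \<in> regions H"
  shows "\<exists>g. minimal_gallery H C g D"
  using assms
proof (induction "card (inversions H C D)" arbitrary: C)
  case 0
  then have "C = D" using inversions_empty_iff by (simp add: finite_inversions)
  then show ?case using 0 minimal_gallery_Nil by blast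
next
  case (Suc n)
  then have "C \<noteq> D" using inversions_same by auto
  then obtain E h where E: "E \<in> regions H" "inversions H C E = {h}" "h \<in> inversions H C D"
    using first_step_exists Suc.prems by blast
  then have "inversions H E D = inversions H C D - {h}"
    using inversions_step[OF Suc.prems(1) E(1) Suc.prems(2) E(2)] by simp
  then have "n = card (inversions H E D)" using Suc.hyps(2) E(3) by (simp add: finite_inversions)
  then obtain g where "minimal_gallery H E g D" using Suc.hyps(1) E(1) Suc.prems by blast
  then have "minimal_gallery H C (Fwd C E # g) D"
    using E Suc.prems by (auto simp: minimal_gallery_Cons)
  then show ?case by blast
qed

lemma gal: "C \<in> regions H \<Longrightarrow> D \<in> regions H \<Longrightarrow> minimal_gallery H C (gal H C D) D"
  unfolding gal_def using minimal_gallery_exists by (rule someI_ex)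

section \<open>Homotopy of minimal galleries\<close>

text \<open>Adding a small multiple of a point of \<open>X\<close> turns weak inequalities into
  strict ones, so every point of the closed cone is a limit of points of \<open>X\<close>.\<close>

lemma closure_region:
  assumes X: "X \<in> regions H"
  shows "closure X = {v. \<forall>h\<in>H. 0 \<le> inward X h \<bullet> v}"
proof
  have "closed (\<Inter>h\<in>H. {v. 0 \<le> inward X h \<bullet> v})"
    by (intro closed_INT ballI closed_halfspace_ge)
  moreover have "(\<Inter>h\<in>H. {v. 0 \<le> inward X h \<bullet> v}) = {v. \<forall>h\<in>H. 0 \<le> inward X h \<bullet> v}" by auto
  moreover have "X \<subseteq> {v. \<forall>h\<in>H. 0 \<le> inward X h \<bullet> v}"
    using mem_region[OF X] less_imp_le by blast
  ultimately show "closure X \<subseteq> {v. \<forall>h\<in>H. 0 \<le> inward X h \<bullet> v}"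
    by (intro closure_minimal) auto
  show "{v. \<forall>h\<in>H. 0 \<le> inward X h \<bullet> v} \<subseteq> closure X"
  proof
    fix v assume v: "v \<in> {v. \<forall>h\<in>H. 0 \<le> inward X h \<bullet> v}"
    obtain x where x: "x \<in> X" using region_nonempty[OF X] by blast
    have in_X: "v + e *\<^sub>R x \<in> X" if "0 < e" for e
    proof -
      have "0 < inward X h \<bullet> (v + e *\<^sub>R x)" if h: "h \<in> H" for h
        using v h mem_region[OF X, of x] x \<open>0 < e\<close> by (simp add: inner_add_right add_nonneg_pos)
      then show ?thesis using mem_region[OF X] by blast
    qed
    have "((\<lambda>e. v + e *\<^sub>R x) \<longlongrightarrow> v + 0 *\<^sub>R x) (at_right 0)" by (intro tendsto_intros)
    moreover have "eventually (\<lambda>e. v + e *\<^sub>R x \<in> closure X) (at_right 0)"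
      using eventually_at_right_less[of "0::real"]
      by (rule eventually_mono) (use in_X closure_subset in blast)
    ultimately show "v \<in> closure X"
      using Lim_in_closed_set[OF closed_closure _ trivial_limit_at_right_real] by fastforce
  qed
qed

lemma open_nearest:
  assumes "C \<in> regions H"
  shows "open {x. nearest C D y h x}"
proof (cases "h \<in> inversions H C D")
  case True
  have "{x. nearest C D y h x} = C \<inter> (\<Inter>j\<in>inversions H C D - {h}.
      {x. scaled C y h \<bullet> x < scaled C y j \<bullet> x})"
    using True by (auto simp: nearest_def)
  moreover have "open \<dots>"
    using region_open[OF assms] finite_inversions
    by (intro open_Int open_INT ballI open_Collect_less continuous_intros) auto
  ultimately show ?thesis by simp
next
  case False
  then show ?thesis by (simp add: nearest_def)
qed

text \<open>Converse to \<open>step_of_nearest\<close>. Take \<open>z\<close> on \<open>h\<close>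
  but on no other hyperplane and start at \<open>z - e *\<^sub>R y\<close>: \<open>h\<close> is
  crossed at time \<open>e\<close>, and every other separating hyperplane later, as its functional
  is positive at \<open>z\<close>.\<close>

lemma nearest_of_step:
  assumes C: "C \<in> regions H" and D: "D \<in> regions H" and y: "y \<in> D"
    and E: "E \<in> regions H" "inversions H C E = {h}" and h: "h \<in> inversions H C D"
  obtains x where "nearest C D y h x"
proof -
  obtain u w where u: "u \<in> C" and w: "w \<in> E" using region_nonempty C E(1) by blast
  have uu: "0 < inward C j \<bullet> u" if "j \<in> H" for j using mem_region[OF C] u that by blast
  have hw: "inward C h \<bullet> w < 0" using mem_inversions[OF C E(1) w, of h] E(2) by simp
  have hH: "h \<in> H" using h inversions_subset by blast
  have ww: "0 \<le> inward C j \<bullet> w" if "j \<in> H" "j \<noteq> h" for j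
    using mem_inversions[OF C E(1) w, of j] E(2) that by (simp add: not_less)
  \<comment> \<open>The parameter at which the segment from \<open>u\<close> to \<open>w\<close>
    meets \<open>h\<close>, the only hyperplane separating its ends.\<close>
  define t where "t = (inward C h \<bullet> u) / (inward C h \<bullet> u - inward C h \<bullet> w)"
  have t: "0 < t" "t < 1" "(1 - t) * (inward C h \<bullet> u) + t * (inward C h \<bullet> w) = 0"
    using uu[OF hH] hw by (simp_all add: t_def field_simps)
  define z where "z = (1 - t) *\<^sub>R u + t *\<^sub>R w"
  have z: "inward C h \<bullet> z = 0" "\<And>j. j \<in> H \<Longrightarrow> j \<noteq> h \<Longrightarrow> 0 < inward C j \<bullet> z"
    using t uu ww by (simp_all add: z_def inner_add_right add_pos_nonneg)
  have hy: "inward C h \<bullet> y < 0" using mem_inversions[OF C D y] h by blast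
  have "eventually (\<lambda>e. 0 < inward C j \<bullet> (z - e *\<^sub>R y)) (at_right 0)" if "j \<in> H" for j
  proof (cases "j = h")
    case True
    show ?thesis using eventually_at_right_less[of "0::real"]
      by (rule eventually_mono) (use True z(1) hy in \<open>simp add: inner_diff_right mult_pos_neg\<close>)
  next
    case False
    from eventually_small_pos[OF z(2)[OF that False], of "- (inward C j \<bullet> y)"] show ?thesis
      by (rule eventually_mono) (simp add: inner_diff_right)
  qed
  then have "eventually (\<lambda>e. \<forall>j\<in>H. 0 < inward C j \<bullet> (z - e *\<^sub>R y)) (at_right 0)"
    using finite_H by (intro eventually_ball_finite) auto
  then obtain e where e: "\<forall>j\<in>H. 0 < inward C j \<bullet> (z - e *\<^sub>R y)"
    using eventually_happens'[OF trivial_limit_at_right_real] by blast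
  have "scaled C y h \<bullet> (z - e *\<^sub>R y) < scaled C y j \<bullet> (z - e *\<^sub>R y)"
    if j: "j \<in> inversions H C D" "j \<noteq> h" for j
  proof -
    have jy: "inward C j \<bullet> y < 0" "j \<in> H" using mem_inversions[OF C D y] j by blast+
    have "0 < scaled C y j \<bullet> z"
      using z(2)[OF jy(2) j(2)] scaled_pos_iff[OF jy(1)] by simp
    moreover have "scaled C y h \<bullet> z = 0" using scaled_eq_0_iff[OF hy] z(1) by simp
    ultimately show ?thesis
      using scaled_self[OF hy] scaled_self[OF jy(1)] by (simp add: inner_diff_right)
  qed
  moreover have "z - e *\<^sub>R y \<in> C" using mem_region[OF C] e by blast
  ultimately have "nearest C D y h (z - e *\<^sub>R y)" using h by (simp add: nearest_def)
  then show ?thesis by (rule that)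
qed

text \<open>Where several hyperplanes tie for being met first, collinearity of their functionals says that
  they all contain the intersection of two of them.\<close>

lemma codim2_face_at_tie:
  assumes C: "C \<in> regions H" and D: "D \<in> regions H" and y: "y \<in> D" and x: "x \<in> C"
    and J: "J = {j\<in>inversions H C D. scaled C y j \<bullet> x = m}"
    and m: "\<And>j. j \<in> inversions H C D \<Longrightarrow> m \<le> scaled C y j \<bullet> x"
    and ik: "i \<in> J" "k \<in> J" "i \<noteq> k"
    and line: "\<And>j. j \<in> J \<Longrightarrow> \<exists>t. scaled C y i - scaled C y j = t *\<^sub>R (scaled C y i - scaled C y k)"
  obtains E F where "E \<in> regions H" "inversions H C E = J" "codim2_face H F" "{h\<in>H. F \<subseteq> h} = J"
    "\<And>X. X \<in> regions H \<Longrightarrow> inversions H C X \<subseteq> J \<Longrightarrow> F \<subseteq> closure X"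
proof -
  let ?c = "scaled C y"
  have Jy: "inward C j \<bullet> y < 0" and JH: "j \<in> H" if "j \<in> J" for j
    using mem_inversions[OF C D y] that J by blast+
  have m0: "0 < m" using scaled_pos[OF C JH Jy x, of i] ik(1) by (auto simp: J)
  \<comment> \<open>The point where the tied hyperplanes are met: it lies on those in
    \<open>J\<close> and on no others.\<close>
  define z where "z = x + m *\<^sub>R y"
  have z: "if j \<in> J then inward C j \<bullet> z = 0 else 0 < inward C j \<bullet> z" if "j \<in> H" for j
  proof -
    have "if j \<in> inversions H C D \<and> ?c j \<bullet> x = m then inward C j \<bullet> z = 0
      else 0 < inward C j \<bullet> z"
      unfolding z_def by (rule touching_point[OF C D y x m0 _ that]) (rule m)
    then show ?thesis by (simp add: J)
  qed
  have z_nonneg: "0 \<le> inward C j \<bullet> z" if "j \<in> H" for j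
    using z[OF that] by (auto split: if_splits)
  then obtain E where E: "E \<in> regions H" "inversions H C E = {j\<in>H. inward C j \<bullet> z = 0}"
    by (rule region_beyond[OF C])
  have "j \<in> H \<and> inward C j \<bullet> z = 0 \<longleftrightarrow> j \<in> J" for j
    using z[of j] JH[of j] by (auto split: if_splits)
  then have EJ: "inversions H C E = J" using E(2) by simp
  define L where "L = {v. ?c i \<bullet> v = 0 \<and> ?c k \<bullet> v = 0}"
  \<comment> \<open>Both functionals are nonnegative on \<open>closure C\<close>, so their sum
    vanishes only where both do. The sum exhibits \<open>closure C \<inter> L\<close> as the face
    cut out by a single supporting hyperplane.\<close>
  define F where "F = closure C \<inter> {v. (?c i + ?c k) \<bullet> v = 0}"
  have L0: "inward C j \<bullet> v = 0" if v: "v \<in> L" and j: "j \<in> J" for v j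
  proof -
    obtain t where t: "?c i - ?c j = t *\<^sub>R (?c i - ?c k)" using line[OF j] by blast
    have "(?c i - ?c j) \<bullet> v = t * ((?c i - ?c k) \<bullet> v)" unfolding t by simp
    then have "?c j \<bullet> v = 0" using v by (simp add: L_def inner_diff_left)
    then show ?thesis using scaled_eq_0_iff[OF Jy[OF j]] by simp
  qed
  have c_nonneg: "0 \<le> ?c j \<bullet> v" if "j \<in> J" "v \<in> closure C" for j v
  proof -
    have "0 \<le> inward C j \<bullet> v" using closure_region[OF C] that JH by blast
    then show ?thesis using scaled_nonneg_iff[OF Jy[OF that(1)]] by simp
  qed
  have FL: "F = closure C \<inter> L"
  proof
    show "closure C \<inter> L \<subseteq> F" by (auto simp: F_def L_def inner_add_left)
    show "F \<subseteq> closure C \<inter> L"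
    proof
      fix v assume "v \<in> F"
      then have v: "v \<in> closure C" "?c i \<bullet> v + ?c k \<bullet> v = 0"
        by (auto simp: F_def inner_add_left)
      with c_nonneg[OF ik(1) v(1)] c_nonneg[OF ik(2) v(1)] show "v \<in> closure C \<inter> L"
        by (auto simp: L_def)
    qed
  qed
  have zF: "z \<in> F"
  proof -
    have "inward C i \<bullet> z = 0" "inward C k \<bullet> z = 0" using z JH ik by force+
    then have "z \<in> L" using scaled_eq_0_iff[OF Jy] ik by (simp add: L_def)
    then show ?thesis using z_nonneg by (simp add: FL closure_region[OF C])
  qed
  have "independent {?c i, ?c k}" and ne: "?c i \<noteq> ?c k"
  proof -
    show ne: "?c i \<noteq> ?c k"
      using scaled_inject[OF JH JH Jy Jy] ik by blast
    \<comment> \<open>Proportional functionals would be equal, since both take the value -1 at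
      \<open>y\<close>.\<close>
    have "?c i \<notin> span {?c k}"
    proof
      assume "?c i \<in> span {?c k}"
      then obtain t where t: "?c i = t *\<^sub>R ?c k" by (auto simp: span_singleton)
      then have "?c i \<bullet> y = t * (?c k \<bullet> y)" by simp
      then have "t = 1" using scaled_self[OF Jy] ik by simp
      then show False using t ne by simp
    qed
    moreover have "?c k \<noteq> 0" using scaled_self[OF Jy[OF ik(2)]] by auto
    ultimately show "independent {?c i, ?c k}" by (simp add: independent_insert)
  qed
  then have dimL: "dim L + 2 = DIM('a)" unfolding L_def by (rule dim_orthogonal_pair)
  have subL: "subspace L" unfolding L_def
    by (intro subspaceI) (auto simp: inner_add_right)
  \<comment> \<open>\<open>T\<close> is a neighbourhood of \<open>z\<close> on which the
    inequalities for the hyperplanes outside \<open>J\<close> hold. Since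
    \<open>L \<inter> T \<subseteq> F \<subseteq> L\<close>, the dimension of \<open>F\<close> is
    that of \<open>L\<close>.\<close>
  define T where "T = (\<Inter>h\<in>H - J. {v. 0 < inward C h \<bullet> v})"
  have "open T" unfolding T_def using finite_H by (intro open_INT) (auto simp: open_halfspace_gt)
  have zT: "z \<in> T" using z by (auto simp: T_def)
  have "L \<inter> T \<subseteq> F"
  proof
    fix v assume v: "v \<in> L \<inter> T"
    have "0 \<le> inward C h \<bullet> v" if "h \<in> H" for h
      using L0[of v h] v that by (cases "h \<in> J") (auto simp: T_def less_imp_le)
    then show "v \<in> F" using v by (simp add: FL closure_region[OF C])
  qed
  then have "aff_dim (L \<inter> T) \<le> aff_dim F" by (rule aff_dim_subset)
  moreover have "aff_dim F \<le> aff_dim L" unfolding FL by (rule aff_dim_subset) simp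
  moreover have "aff_dim (L \<inter> T) = aff_dim L"
    using affine_hull_affine_Int_open[OF subspace_imp_affine[OF subL] \<open>open T\<close>] zF zT
    by (metis FL IntD2 IntI aff_dim_affine_hull empty_iff)
  ultimately have "aff_dim F = int DIM('a) - 2"
    using aff_dim_subspace[OF subL] dimL by linarith
  moreover have "F face_of closure C"
    unfolding F_def
  proof (rule face_of_Int_supporting_hyperplane_ge)
    show "convex (closure C)" using region_convex[OF C] by (rule convex_closure)
    show "0 \<le> (?c i + ?c k) \<bullet> v" if "v \<in> closure C" for v
      using c_nonneg[OF ik(1) that] c_nonneg[OF ik(2) that] by (simp add: inner_add_left)
  qed
  ultimately have cF: "codim2_face H F" using zF C unfolding codim2_face_def by blast
  have in_h: "v \<in> h \<longleftrightarrow> inward C h \<bullet> v = 0" if "h \<in> H" for v h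
  proof -
    have "h = {v. inward C h \<bullet> v = 0}" using inward_normal[OF that, of C] unfolding normal_to_def by blast
    then show ?thesis by blast
  qed
  have FJ: "{h\<in>H. F \<subseteq> h} = J"
  proof
    show "{h\<in>H. F \<subseteq> h} \<subseteq> J"
    proof
      fix h assume "h \<in> {h\<in>H. F \<subseteq> h}"
      then have "h \<in> H" "inward C h \<bullet> z = 0" using zF in_h by blast+
      then show "h \<in> J" using z[of h] by (auto split: if_splits)
    qed
    show "J \<subseteq> {h\<in>H. F \<subseteq> h}" using JH in_h L0 FL by blast
  qed
  have "F \<subseteq> closure X" if X: "X \<in> regions H" "inversions H C X \<subseteq> J" for X
  proof
    fix v assume v: "v \<in> F"
    have "0 \<le> inward X h \<bullet> v" if h: "h \<in> H" for h
    proof (cases "h \<in> J")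
      case True
      then have "inward C h \<bullet> v = 0" using L0 v FL by blast
      then show ?thesis using inward_inversions[OF C X(1) h] by simp
    next
      case False
      then have "inward X h = inward C h" using inward_inversions[OF C X(1) h] X(2) by auto
      then show ?thesis using v h FL closure_region[OF C] by auto
    qed
    then show "v \<in> closure X" using closure_region[OF X(1)] by blast
  qed
  with that[OF E(1) EJ cF FJ] show ?thesis by blast
qed

text \<open>Quantifying over all continuations makes this independent of chosen galleries. It is
  vacuous when \<open>i\<close> or \<open>k\<close> is not a wall of \<open>C\<close>, which is why
  \<open>linked_trans\<close> asks for a region across the middle hyperplane.\<close>

definition linked :: "'a set \<Rightarrow> 'a set \<Rightarrow> 'a set \<Rightarrow> 'a set \<Rightarrow> bool" where
  "linked C D i k \<longleftrightarrow> (\<forall>E E' g g'. E \<in> regions H \<and> E' \<in> regions H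
     \<and> inversions H C E = {i} \<and> inversions H C E' = {k}
     \<and> minimal_gallery H E g D \<and> minimal_gallery H E' g' D
     \<longrightarrow> sal_homotopic H C D (Fwd C E # g) (Fwd C E' # g'))"

lemma linked_trans:
  assumes "C \<in> regions H" "D \<in> regions H" "linked C D i j" "linked C D j k"
    "E \<in> regions H" "inversions H C E = {j}"
  shows "linked C D i k"
  using assms minimal_gallery_exists[OF assms(5,2)] sal_homotopic.trans
  unfolding linked_def by meson

text \<open>Let \<open>E\<close> be opposite \<open>C\<close> about the face given by
  \<open>codim2_face_at_tie\<close>. Applied after the first step, \<open>IH\<close> reroutes any
  gallery that begins across \<open>i\<close> or \<open>k\<close> through \<open>E\<close> and on
  along a fixed \<open>d\<close>; the two initial pieces from \<open>C\<close> to \<open>E\<close>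
  bound a 2-cell.\<close>

lemma linked_at_tie:
  assumes C: "C \<in> regions H" and D: "D \<in> regions H" and y: "y \<in> D" and x: "x \<in> C"
    and J: "J = {j\<in>inversions H C D. scaled C y j \<bullet> x = m}"
    and m: "\<And>j. j \<in> inversions H C D \<Longrightarrow> m \<le> scaled C y j \<bullet> x"
    and ik: "i \<in> J" "k \<in> J" "i \<noteq> k"
    and line: "\<And>j. j \<in> J \<Longrightarrow> \<exists>t. scaled C y i - scaled C y j = t *\<^sub>R (scaled C y i - scaled C y k)"
    and IH: "\<And>E g g'. minimal_gallery H E g D \<Longrightarrow> minimal_gallery H E g' D \<Longrightarrow>
      card (inversions H E D) < card (inversions H C D) \<Longrightarrow> sal_homotopic H E D g g'"
  shows "linked C D i k"
proof -
  obtain E F where E: "E \<in> regions H" "inversions H C E = J" and F: "codim2_face H F"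
      "{h\<in>H. F \<subseteq> h} = J"
      "\<And>X. X \<in> regions H \<Longrightarrow> inversions H C X \<subseteq> J \<Longrightarrow> F \<subseteq> closure X"
    using codim2_face_at_tie[OF C D y x J m ik line] by blast
  have JS: "J \<subseteq> inversions H C D" by (auto simp: J)
  have ED: "inversions H E D = inversions H C D - J"
    using inversions_sym_diff[OF C E(1) D] E(2) JS inversions_sym_diff[OF E(1) C D]
      inversions_commute[OF C E(1)] by auto
  obtain d where d: "minimal_gallery H E d D" using minimal_gallery_exists[OF E(1) D] by blast
  \<comment> \<open>Such galleries cross only members of \<open>J\<close>, so every region on them
    has \<open>F\<close> in its closure.\<close>
  have around: "gallery_around H F C g E" if "minimal_gallery H C g E" for g
    unfolding gallery_around_def
  proof (intro conjI ballI that)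
    fix t assume "t \<in> set g"
    from minimal_gallery_between[OF that this] E(2)
    show "F \<subseteq> closure (step_source t)" "F \<subseteq> closure (step_target t)"
      by (metis F(3))+
  qed
  have cell: "sal_cell H g g'" if "minimal_gallery H C g E" "minimal_gallery H C g' E" for g g'
  proof -
    have "F \<subseteq> closure C" "F \<subseteq> closure E"
      using F(3)[OF C] F(3)[OF E(1)] inversions_same[OF C] E(2) by simp_all
    then have "opposite_about H F C E"
      unfolding opposite_about_def using C E F(2) by simp
    with F(1) around[OF that(1)] around[OF that(2)] show ?thesis
      unfolding sal_cell_def by blast
  qed
  have via: "\<exists>e. minimal_gallery H C (Fwd C X # e) E \<and>
      (\<forall>g. minimal_gallery H X g D \<longrightarrow> sal_homotopic H C D (Fwd C X # g) ((Fwd C X # e) @ d))"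
    if X: "X \<in> regions H" "inversions H C X = {l}" and l: "l \<in> J" for X l
  proof -
    obtain e where e: "minimal_gallery H X e E" using minimal_gallery_exists[OF X(1) E(1)] by blast
    have XE: "inversions H X E = J - {l}" using inversions_step[OF C X(1) E(1) X(2)] E(2) l by simp
    have XD: "inversions H X D = inversions H C D - {l}"
      using inversions_step[OF C X(1) D X(2)] l JS by auto
    have "minimal_gallery H X (e @ d) D"
      by (rule minimal_gallery_append[OF e d]) (use XE ED in blast)
    moreover have "card (inversions H X D) < card (inversions H C D)"
      unfolding XD using l JS by (intro psubset_card_mono finite_inversions) auto
    ultimately have "sal_homotopic H X D g (e @ d)" if "minimal_gallery H X g D" for g
      using IH that by blast
    moreover have "sal_path H C [Fwd C X] X"
      using C X by (auto simp: adjacent_iff)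
    ultimately have "sal_homotopic H C D ([Fwd C X] @ g) ([Fwd C X] @ (e @ d))"
      if "minimal_gallery H X g D" for g
      using sal_homotopic_append_left that by blast
    moreover have "minimal_gallery H C (Fwd C X # e) E"
      using e C X l E by (auto simp: minimal_gallery_Cons)
    ultimately show ?thesis by auto
  qed
  show ?thesis
    unfolding linked_def
  proof (intro allI impI, elim conjE)
    fix X Y g g'
    assume X: "X \<in> regions H" "inversions H C X = {i}" "minimal_gallery H X g D"
      and Y: "Y \<in> regions H" "inversions H C Y = {k}" "minimal_gallery H Y g' D"
    obtain e where e: "minimal_gallery H C (Fwd C X # e) E"
        "sal_homotopic H C D (Fwd C X # g) ((Fwd C X # e) @ d)"
      using via[OF X(1,2) ik(1)] X(3) by blast
    obtain e' where e': "minimal_gallery H C (Fwd C Y # e') E"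
        "sal_homotopic H C D (Fwd C Y # g') ((Fwd C Y # e') @ d)"
      using via[OF Y(1,2) ik(2)] Y(3) by blast
    have "sal_path H C ([] @ (Fwd C X # e) @ d) D"
      using sal_homotopic_paths[OF e(2)] by simp
    from sal_homotopic.cell[OF cell[OF e(1) e'(1)] this]
    have "sal_homotopic H C D ((Fwd C X # e) @ d) ((Fwd C Y # e') @ d)" by simp
    then show "sal_homotopic H C D (Fwd C X # g) (Fwd C Y # g')"
      using e(2) e'(2) sal_homotopic.trans sal_homotopic.sym by meson
  qed
qed

text \<open>Inversion sets determine regions, so both galleries enter the same neighbour and only
  their tails have to be compared.\<close>

lemma linked_refl:
  assumes C: "C \<in> regions H" and D: "D \<in> regions H" and i: "i \<in> inversions H C D"
    and IH: "\<And>E g g'. minimal_gallery H E g D \<Longrightarrow> minimal_gallery H E g' D \<Longrightarrow>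
      card (inversions H E D) < card (inversions H C D) \<Longrightarrow> sal_homotopic H E D g g'"
  shows "linked C D i i"
  unfolding linked_def
proof (intro allI impI, elim conjE)
  fix X Y g g'
  assume X: "X \<in> regions H" "inversions H C X = {i}" "minimal_gallery H X g D"
    and Y: "Y \<in> regions H" "inversions H C Y = {i}" "minimal_gallery H Y g' D"
  have "Y = X" using inversions_inject[OF C Y(1) X(1)] X(2) Y(2) by simp
  have "inversions H X D = inversions H C D - {i}"
    using inversions_step[OF C X(1) D X(2)] i by simp
  then have "card (inversions H X D) < card (inversions H C D)"
    using i finite_inversions by (metis card_Diff1_less)
  then have "sal_homotopic H X D g g'" using IH X(3) Y(3) \<open>Y = X\<close> by blast
  moreover have "sal_path H C [Fwd C X] X"
    using C X by (auto simp: adjacent_iff)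
  ultimately have "sal_homotopic H C D ([Fwd C X] @ g) ([Fwd C X] @ g')"
    by (rule sal_homotopic_append_left)
  then show "sal_homotopic H C D (Fwd C X # g) (Fwd C Y # g')" using \<open>Y = X\<close> by simp
qed

text \<open>\<open>x\<close> and then \<open>x'\<close> are chosen so generically that on the segment between them all functionals
  tying at one point are collinear: otherwise one of the finitely many vectors \<open>v (a, b, c) \<noteq> 0\<close>
  would be orthogonal to \<open>x'\<close>.\<close>

lemma linked_nearest:
  assumes C: "C \<in> regions H" and D: "D \<in> regions H" and y: "y \<in> D"
    and ni: "nearest C D y i x0" and nk: "nearest C D y k x1"
    and IH: "\<And>E g g'. minimal_gallery H E g D \<Longrightarrow> minimal_gallery H E g' D \<Longrightarrow>
      card (inversions H E D) < card (inversions H C D) \<Longrightarrow> sal_homotopic H E D g g'"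
  shows "linked C D i k"
proof -
  let ?S = "inversions H C D" and ?c = "scaled C y"
  obtain x where x: "nearest C D y i x" and xg: "\<And>h j. h \<in> ?S \<Longrightarrow> j \<in> ?S \<Longrightarrow> h \<noteq> j \<Longrightarrow>
      (?c h - ?c j) \<bullet> x \<noteq> 0"
    using generic_point[OF C D y open_nearest[OF C]] ni by blast
  \<comment> \<open>\<open>v (a, b, c)\<close> is orthogonal to \<open>x\<close> by construction
    and, as \<open>x\<close> has no ties, vanishes only if the two differences are linearly
    dependent. A tie of all three at \<open>p s\<close> with \<open>s \<noteq> 0\<close> makes it
    orthogonal to \<open>x'\<close> as well.\<close>
  define v where "v = (\<lambda>(a, b, c). ((?c a - ?c b) \<bullet> x) *\<^sub>R (?c a - ?c c) - ((?c a - ?c c) \<bullet> x) *\<^sub>R (?c a - ?c b))"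
  obtain x' where x': "nearest C D y k x'" and x'g: "\<And>w. w \<in> v ` (?S \<times> ?S \<times> ?S) - {0} \<Longrightarrow> w \<bullet> x' \<noteq> 0"
    using open_avoids_hyperplanes[of "v ` (?S \<times> ?S \<times> ?S) - {0}" "{x. nearest C D y k x}"]
      open_nearest[OF C] nk finite_inversions by auto
  have xC: "x \<in> C" "x' \<in> C" using x x' by (auto simp: nearest_def)
  define p where "p s = (1 - s) *\<^sub>R x + s *\<^sub>R x'" for s :: real
  have pC: "p s \<in> C" if "s \<in> {0..1}" for s
    using convexD_alt[OF region_convex[OF C] xC] that by (simp add: p_def)
  \<comment> \<open>\<open>P\<close> leaves out the finitely many parameters with a tie for the
    first place.\<close>
  define P where "P s \<longleftrightarrow> s \<in> {0..1} \<and> (\<exists>j. nearest C D y j (p s))" for s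
  define R where "R s t \<longleftrightarrow> P s \<and> P t \<and>
    (\<forall>i k. nearest C D y i (p s) \<longrightarrow> nearest C D y k (p t) \<longrightarrow> linked C D i k)" for s t
  have cont: "continuous_on UNIV (\<lambda>s. ?c j \<bullet> p s)" for j
    unfolding p_def by (intro continuous_intros)
  \<comment> \<open>Connectedness of the interval replaces an enumeration of the parameters where
    the first wall changes. What remains is that \<open>R\<close> is transitive, that
    \<open>P\<close> is dense, and that \<open>R\<close> relates nearby points of
    \<open>P\<close>.\<close>
  have "R 0 1"
  proof (rule connected_equivalence_relation_gen[where S = "{0..1::real}" and P = P])
    show "connected {0..1::real}" by simp
    show "P 0" "P 1" using x x' by (auto simp: P_def p_def)
  next
    fix a b c assume ab: "R a b" and bc: "R b c"
    then obtain j where j: "nearest C D y j (p b)" by (auto simp: R_def P_def)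
    obtain E where "E \<in> regions H" "inversions H C E = {j}" using step_of_nearest[OF C D y j] .
    then show "R a c"
      using ab bc j linked_trans[OF C D] unfolding R_def by blast
  next
    fix T and a :: real assume T: "openin (top_of_set {0..1}) T" "a \<in> T"
    \<comment> \<open>The difference of two crossing times is affine in \<open>s\<close> and nonzero
      at \<open>s = 0\<close>, so each pair ties at most once. Hence \<open>Z\<close> is finite,
      whereas \<open>T\<close> is infinite.\<close>
    define Z where "Z = {s. \<exists>h\<in>?S. \<exists>j\<in>?S. h \<noteq> j \<and> (?c h - ?c j) \<bullet> p s = 0}"
    have fin: "finite {s. (?c h - ?c j) \<bullet> p s = 0}" if hj: "h \<in> ?S" "j \<in> ?S" "h \<noteq> j" for h j
    proof -
      let ?u = "(?c h - ?c j) \<bullet> x" and ?w = "(?c h - ?c j) \<bullet> x'"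
      have "s = ?u / (?u - ?w)" if "(?c h - ?c j) \<bullet> p s = 0" for s
      proof -
        have e: "?u = s * (?u - ?w)"
          using that by (simp add: p_def inner_add_right algebra_simps)
        moreover have "?u - ?w \<noteq> 0" using e xg[OF hj] by auto
        ultimately show ?thesis by (simp add: field_simps)
      qed
      then have "{s. (?c h - ?c j) \<bullet> p s = 0} \<subseteq> {?u / (?u - ?w)}" by blast
      then show ?thesis by (rule finite_subset) simp
    qed
    have "Z = (\<Union>h\<in>?S. \<Union>j\<in>?S - {h}. {s. (?c h - ?c j) \<bullet> p s = 0})" by (auto simp: Z_def)
    then have "finite Z" using fin finite_inversions by (auto intro!: finite_UN_I)
    moreover have "infinite T"
    proof -
      obtain e where e: "0 < e" "\<And>s. s \<in> {0..1} \<Longrightarrow> dist s a < e \<Longrightarrow> s \<in> T"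
        using T by (auto simp: openin_euclidean_subtopology_iff)
      have a: "0 \<le> a" "a \<le> 1" using T openin_imp_subset by fastforce+
      have "{max 0 (a - e)<..<min 1 (a + e)} \<subseteq> T"
        using e(2) by (force simp: dist_real_def)
      moreover have "infinite {max 0 (a - e)<..<min 1 (a + e)}"
        using e(1) a by (intro infinite_Ioo) auto
      ultimately show ?thesis using finite_subset by blast
    qed
    ultimately obtain s where s: "s \<in> T" "s \<notin> Z" by (meson finite_subset subsetI)
    have s01: "s \<in> {0..1}" using s(1) T(1) openin_imp_subset by blast
    have "C \<noteq> D" using ni inversions_same[OF C] by (auto simp: nearest_def)
    moreover have "inj_on (\<lambda>h. ?c h \<bullet> p s) ?S"
      using s(2) by (intro inj_onI) (force simp: Z_def inner_diff_left)
    ultimately obtain h where "h \<in> ?S" "\<And>j. j \<in> ?S \<Longrightarrow> j \<noteq> h \<Longrightarrow> ?c h \<bullet> p s < ?c j \<bullet> p s"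
      using generic_argmin[OF C D] by blast
    then have "P s" using s01 pC[OF s01] by (auto simp: P_def nearest_def)
    with s(1) show "\<exists>z. z \<in> T \<and> P z" by blast
  next
    fix s :: real assume s: "s \<in> {0..1}"
    have S: "finite ?S" "?S \<noteq> {}" using ni finite_inversions by (auto simp: nearest_def)
    define m where "m = Min ((\<lambda>j. ?c j \<bullet> p s) ` ?S)"
    define J where "J = {j\<in>?S. ?c j \<bullet> p s = m}"
    have m: "m \<le> ?c j \<bullet> p s" if "j \<in> ?S" for j
      unfolding m_def using S that by simp
    have "m \<in> (\<lambda>j. ?c j \<bullet> p s) ` ?S" unfolding m_def using S by (intro Min_in) auto
    then obtain j0 where j0: "j0 \<in> J" by (auto simp: J_def)
    \<comment> \<open>Near \<open>s\<close> the hyperplanes outside \<open>J\<close> are still met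
      after \<open>j0\<close>, so only members of \<open>J\<close> can come first.\<close>
    define T where "T = (\<Inter>j\<in>?S - J. {t. ?c j0 \<bullet> p t < ?c j \<bullet> p t})"
    have "open T"
      unfolding T_def using S cont by (intro open_INT ballI open_Collect_less) auto
    have "s \<in> T" using j0 m by (fastforce simp: T_def J_def)
    have inJ: "l \<in> J" if "t \<in> T" "nearest C D y l (p t)" for l t
    proof (rule ccontr)
      assume "l \<notin> J"
      then have "?c j0 \<bullet> p t < ?c l \<bullet> p t" using that by (auto simp: T_def nearest_def)
      moreover have "j0 \<in> ?S" using j0 by (simp add: J_def)
      ultimately show False using that(2) by (auto simp: nearest_def dest!: bspec[of _ _ j0])
    qed
    have "linked C D a b" if ab: "a \<in> J" "b \<in> J" for a b
    proof (cases "a = b")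
      case True
      have "a \<in> ?S" using ab(1) by (simp add: J_def)
      from linked_refl[OF C D this IH] True show ?thesis by blast
    next
      case False
      have line: "\<exists>t. ?c a - ?c j = t *\<^sub>R (?c a - ?c b)" if j: "j \<in> J" for j
      proof -
        have S: "a \<in> ?S" "b \<in> ?S" "j \<in> ?S" using ab j by (auto simp: J_def)
        have e: "(?c a - ?c j) \<bullet> p s = 0" "(?c a - ?c b) \<bullet> p s = 0"
          using ab j by (simp_all add: J_def inner_diff_left)
        have ns: "s \<noteq> 0" using e(2) xg[OF S(1,2) False] by (auto simp: p_def)
        have "v (a, j, b) \<bullet> p s = 0" using e by (simp add: v_def inner_diff_left)
        moreover have "v (a, j, b) \<bullet> x = 0" by (simp add: v_def inner_diff_left)
        ultimately have "v (a, j, b) \<bullet> x' = 0" using ns by (simp add: p_def inner_add_right)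
        then have "v (a, j, b) = 0" using x'g[of "v (a, j, b)"] S by blast
        then have "((?c a - ?c b) \<bullet> x) *\<^sub>R (?c a - ?c j) = ((?c a - ?c j) \<bullet> x) *\<^sub>R (?c a - ?c b)"
          by (simp add: v_def)
        then have "?c a - ?c j = (((?c a - ?c j) \<bullet> x) / ((?c a - ?c b) \<bullet> x)) *\<^sub>R (?c a - ?c b)"
          using xg[OF S(1,2) False]
          by (metis (no_types, lifting) divide_inverse_commute scaleR_left_imp_eq scaleR_scaleR
              nonzero_mult_div_cancel_left times_divide_eq_right)
        then show ?thesis by blast
      qed
      show ?thesis
        by (rule linked_at_tie[OF C D y pC[OF s] J_def _ ab False]) (use m line IH in blast)+
    qed
    then have "\<forall>t\<in>T. \<forall>u\<in>T. P t \<and> P u \<longrightarrow> R t u"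
      using inJ by (auto simp: R_def)
    then show "\<exists>T. openin (top_of_set {0..1}) T \<and> s \<in> T \<and> (\<forall>x\<in>T. \<forall>y\<in>T. P x \<and> P y \<longrightarrow> R x y)"
      using \<open>open T\<close> \<open>s \<in> T\<close> s by (intro exI[of _ "{0..1} \<inter> T"]) (auto simp: openin_open_Int)
  qed auto
  then show ?thesis using x x' by (auto simp: R_def p_def)
qed

text \<open>\<open>D\<close> stays fixed while the start varies, so the induction hypothesis covers
  the tails of both galleries and the detours made in \<open>linked_at_tie\<close>.\<close>

lemma minimal_galleries_homotopic:
  assumes "minimal_gallery H C g D" "minimal_gallery H C g' D"
  shows "sal_homotopic H C D g g'"
  using assms
proof (induction "card (inversions H C D)" arbitrary: C g g' rule: less_induct)
  case less
  have CD: "C \<in> regions H" "D \<in> regions H" using less.prems minimal_gallery_regions by blast+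
  have len: "length g = length g'" using less.prems by (simp add: minimal_gallery_def)
  show ?case
  proof (cases g)
    case Nil
    then show ?thesis
      using len less.prems by (auto intro!: sal_homotopic.refl dest: minimal_gallery_path)
  next
    case (Cons s f)
    then obtain s' f' where g': "g' = s' # f'" using len by (metis length_Suc_conv)
    obtain E h where E: "s = Fwd C E" "E \<in> regions H" "inversions H C E = {h}"
        "h \<in> inversions H C D" "minimal_gallery H E f D"
      using less.prems(1) by (auto simp: Cons minimal_gallery_Cons)
    obtain E' h' where E': "s' = Fwd C E'" "E' \<in> regions H" "inversions H C E' = {h'}"
        "h' \<in> inversions H C D" "minimal_gallery H E' f' D"
      using less.prems(2) by (auto simp: g' minimal_gallery_Cons)
    obtain y where y: "y \<in> D" using region_nonempty[OF CD(2)] by blast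
    obtain x where x: "nearest C D y h x" using nearest_of_step[OF CD y E(2-4)] .
    obtain x' where x': "nearest C D y h' x'" using nearest_of_step[OF CD y E'(2-4)] .
    have "linked C D h h'"
      by (rule linked_nearest[OF CD y x x']) (rule less.hyps)
    then show ?thesis
      using E E' unfolding linked_def Cons g' by blast
  qed
qed

end

section \<open>The antipodal anti-automorphism\<close>

text \<open>The duality sends \<open>x\<close> with \<open>d = x q\<close> to the image of \<open>q\<close> under the anti-automorphism.\<close>

lemma (in group) self_dual_on_divisors:
  assumes M: "submonoid M G" and f: "f \<in> carrier G \<rightarrow> carrier G"
    and anti: "\<And>x y. x \<in> carrier G \<Longrightarrow> y \<in> carrier G \<Longrightarrow> f (x \<otimes> y) = f y \<otimes> f x"
    and invol: "\<And>x. x \<in> carrier G \<Longrightarrow> f (f x) = x"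
    and fM: "\<And>x. x \<in> M \<Longrightarrow> f x \<in> M"
    and d: "d \<in> carrier G" "f d = d"
  shows "self_dual_on {x\<in>M. \<exists>q\<in>M. d = x \<otimes> q} (\<lambda>x y. x \<in> M \<and> y \<in> M \<and> (\<exists>q\<in>M. y = x \<otimes> q))"
    (is "self_dual_on ?P ?R")
proof -
  interpret M: submonoid M G by (rule M)
  define g where "g x = f (inv x \<otimes> d)" for x
  have g: "g x = f q" if "x \<in> M" "q \<in> M" "d = x \<otimes> q" for x q
    using that by (simp add: g_def inv_solve_left[symmetric] m_assoc[symmetric])
  have gP: "g x \<in> ?P \<and> g (g x) = x" if x: "x \<in> ?P" for x
  proof -
    obtain q where q: "x \<in> M" "q \<in> M" "d = x \<otimes> q" using x by blast
    \<comment> \<open>Applying \<open>f\<close> to \<open>d = x \<otimes> q\<close> exchanges the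
      roles: \<open>f q\<close> is a divisor with cofactor \<open>f x\<close>. This gives both that
      \<open>g\<close> preserves the divisors and that it is an involution on them.\<close>
    then have e: "d = f q \<otimes> f x" using anti[of x q] d(2) by simp
    then have "g (f q) = f (f x)" using g fM q by blast
    moreover have "f q \<in> ?P" using e fM q by blast
    ultimately show ?thesis using g[OF q] q(1) invol by simp
  qed
  have "?R (g y) (g x)" if xy: "x \<in> ?P" "y \<in> ?P" "?R x y" for x y
  proof -
    obtain r where r: "r \<in> M" "y = x \<otimes> r" using xy(3) by blast
    obtain q where q: "y \<in> M" "q \<in> M" "d = y \<otimes> q" using xy(2) by blast
    then have "d = x \<otimes> (r \<otimes> q)" using r xy(3) by (simp add: m_assoc)
    then have "g x = f (r \<otimes> q)" using g r(1) q(2) xy(3) M.m_closed by blast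
    then have "g x = g y \<otimes> f r" using g[OF q] anti r q by simp
    then show ?thesis using gP xy(1,2) fM r(1) by blast
  qed
  then have "?R x y \<longleftrightarrow> ?R (g y) (g x)" if "x \<in> ?P" "y \<in> ?P" for x y
    using gP that by (metis (no_types, lifting))
  moreover have "bij_betw g ?P ?P"
    using gP by (intro bij_betwI[where g = g]) auto
  ultimately show ?thesis
    unfolding self_dual_on_def by blast
qed

section \<open>The antipodal reversal of paths\<close>

fun antistep :: "'a::euclidean_space set step \<Rightarrow> 'a set step" where
  "antistep (Fwd D D') = Fwd (uminus ` D') (uminus ` D)"
| "antistep (Bwd D D') = Bwd (uminus ` D') (uminus ` D)"

text \<open>The order of the steps and the direction of each edge are reversed together, so forward
  steps stay forward and positive galleries stay positive; \<open>path_inverse\<close> would make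
  them run backwards.\<close>

definition antipath :: "'a::euclidean_space set step list \<Rightarrow> 'a set step list" where
  "antipath p = rev (map antistep p)"

lemma antistep_antistep: "antistep (antistep s) = s"
  by (cases s) (simp_all add: image_image)

lemma antistep_inverse: "antistep (step_inverse s) = step_inverse (antistep s)"
  by (cases s) simp_all

lemma antistep_source [simp]: "step_source (antistep s) = uminus ` step_target s"
  and antistep_target [simp]: "step_target (antistep s) = uminus ` step_source s"
  by (cases s; simp)+

lemma antipath_Nil [simp]: "antipath [] = []"
  by (simp add: antipath_def)

lemma antipath_append [simp]: "antipath (p @ q) = antipath q @ antipath p"
  by (simp add: antipath_def)

lemma antipath_antipath [simp]: "antipath (antipath p) = p"
  by (simp add: antipath_def rev_map antistep_antistep o_def)

lemma antipath_inverse: "antipath (path_inverse p) = path_inverse (antipath p)"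
  by (simp add: antipath_def path_inverse_def rev_map antistep_inverse)

lemma length_antipath [simp]: "length (antipath p) = length p"
  by (simp add: antipath_def)

lemma set_antipath: "set (antipath p) = antistep ` set p"
  by (simp add: antipath_def)

lemma path_inverse_path_inverse [simp]:
  fixes p :: "'v step list"
  shows "path_inverse (path_inverse p) = p"
proof -
  have "step_inverse (step_inverse t) = t" for t :: "'v step" by (cases t) simp_all
  then show ?thesis by (simp add: path_inverse_def rev_map[symmetric] comp_def)
qed

context arrangement
begin

text \<open>\<open>- x\<close> has the opposite sign on every hyperplane, so its region is given by
  the negated inequalities, which describe -C.\<close>

lemma antipodal_region:
  assumes C: "C \<in> regions H"
  shows "uminus ` C \<in> regions H" "inversions H C (uminus ` C) = H"
proof -
  obtain x where x: "x \<in> C" using region_nonempty[OF C] by blast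
  have xp: "0 < inward C h \<bullet> x" if "h \<in> H" for h using mem_region[OF C] x that by blast
  obtain E where E: "E \<in> regions H" "inversions H C E = {h\<in>H. inward C h \<bullet> (- x) < 0}"
    using region_with_inversions[OF C, of "- x"] xp by force
  have EH: "inversions H C E = H" using E(2) xp by auto
  have iE: "inward E h = - inward C h" if "h \<in> H" for h
    using inward_inversions[OF C E(1) that] EH that by simp
  have "y \<in> E \<longleftrightarrow> - y \<in> C" for y
    using mem_region[OF C, of "- y"] mem_region[OF E(1), of y] iE by simp
  moreover have "y \<in> uminus ` C \<longleftrightarrow> - y \<in> C" for y
    by (force simp: image_iff)
  ultimately have "E = uminus ` C" by blast
  with E(1) EH show "uminus ` C \<in> regions H" "inversions H C (uminus ` C) = H" by simp_all
qed

lemma opposite_eq: "C \<in> regions H \<Longrightarrow> opposite H C = uminus ` C"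
  unfolding opposite_def
  using antipodal_region inversions_inject by (intro the_equality) (metis, metis)

lemma inversions_antipodal_right:
  assumes "C \<in> regions H" "D \<in> regions H"
  shows "inversions H C (uminus ` D) = H - inversions H C D"
  using inversions_sym_diff[OF assms antipodal_region(1)[OF assms(2)]]
    antipodal_region(2)[OF assms(2)] inversions_subset[of C D] by auto

text \<open>Each antipode complements the inversion set, and the two complements cancel.\<close>

lemma inversions_antipodal:
  assumes "C \<in> regions H" "D \<in> regions H"
  shows "inversions H (uminus ` D) (uminus ` C) = inversions H C D"
  using inversions_antipodal_right[OF antipodal_region(1)[OF assms(2)] assms(1)]
    inversions_antipodal_right[OF assms] inversions_commute[OF assms(1) antipodal_region(1)[OF assms(2)]]
    inversions_subset[of C D] by auto

lemma adjacent_antipodal: "adjacent H C D \<Longrightarrow> adjacent H (uminus ` D) (uminus ` C)"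
  by (auto simp: adjacent_iff antipodal_region inversions_antipodal)

lemma sal_step_antistep: "sal_step H s \<Longrightarrow> sal_step H (antistep s)"
  by (cases s) (auto intro: adjacent_antipodal)

lemma sal_path_antipath:
  "sal_path H C p D \<Longrightarrow> sal_path H (uminus ` D) (antipath p) (uminus ` C)"
proof (induction p arbitrary: C)
  case Nil
  then show ?case by (auto simp: antipodal_region)
next
  case (Cons s p)
  then have s: "sal_step H (antistep s)" "step_source s = C"
    and p: "sal_path H (uminus ` D) (antipath p) (uminus ` step_target s)"
    by (auto intro: sal_step_antistep)
  have "C \<in> regions H" using sal_path_source[OF Cons.prems] .
  then have "sal_path H (uminus ` step_target s) [antistep s] (uminus ` C)"
    using s by (auto simp: antipodal_region)
  moreover have "antipath (s # p) = antipath p @ [antistep s]" by (simp add: antipath_def)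
  ultimately show ?case using p sal_path_append by metis
qed

lemma minimal_gallery_antipath:
  assumes "minimal_gallery H C g D"
  shows "minimal_gallery H (uminus ` D) (antipath g) (uminus ` C)"
proof -
  have CD: "C \<in> regions H" "D \<in> regions H" using assms minimal_gallery_regions by blast+
  have "\<exists>E E'. antistep s = Fwd E E'" if "s \<in> set g" for s
    using assms that by (fastforce simp: minimal_gallery_def positive_gallery_def)
  then show ?thesis
    using assms sal_path_antipath inversions_antipodal[OF CD]
    by (auto simp: minimal_gallery_def positive_gallery_def set_antipath)
qed

lemma codim2_face_antipodal:
  assumes "codim2_face H F"
  shows "codim2_face H (uminus ` F)"
proof -
  obtain C where C: "C \<in> regions H" "F face_of closure C" and F: "F \<noteq> {}" "aff_dim F = int DIM('a) - 2"
    using assms by (auto simp: codim2_face_def)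
  have lin: "linear (uminus :: 'a \<Rightarrow> 'a)" and inj: "inj (uminus :: 'a \<Rightarrow> 'a)"
    by (auto simp: linear_iff inj_def)
  have "uminus ` F face_of closure (uminus ` C)"
    using face_of_linear_image[OF lin inj] C(2) closure_injective_linear_image[OF lin inj] by metis
  moreover have "aff_dim (uminus ` F) = aff_dim F"
    using aff_dim_injective_linear_image[OF lin inj] .
  ultimately show ?thesis
    using C(1) F antipodal_region(1) unfolding codim2_face_def by auto
qed

text \<open>The ends are exchanged: \<open>C\<close> and \<open>D\<close>, opposite about F, become
  -D and -C, opposite about -F, and a central hyperplane contains -F if and only if it contains
  F.\<close>

lemma sal_cell_antipath:
  assumes "sal_cell H g g'"
  shows "sal_cell H (antipath g) (antipath g')"
proof -
  obtain F C D where F: "codim2_face H F" and o: "opposite_about H F C D"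
    and g: "gallery_around H F C g D" "gallery_around H F C g' D"
    using assms by (auto simp: sal_cell_def)
  have cl: "uminus ` F \<subseteq> closure (uminus ` X)" if "F \<subseteq> closure X" for X
    using that closure_injective_linear_image[of "uminus :: 'a \<Rightarrow> 'a" X]
    by (auto simp: linear_iff inj_def)
  have sub: "uminus ` F \<subseteq> h \<longleftrightarrow> F \<subseteq> h" if "h \<in> H" for h
  proof -
    have "h = {x. normal_of h \<bullet> x = 0}" using normal_of[OF that] unfolding normal_to_def by blast
    then have "- x \<in> h \<longleftrightarrow> x \<in> h" for x by (metis (mono_tags) inner_minus_right mem_Collect_eq neg_equal_0_iff_equal)
    then show ?thesis by (auto simp: subset_iff)
  qed
  have "opposite_about H (uminus ` F) (uminus ` D) (uminus ` C)"
    using o sub cl antipodal_region(1) inversions_antipodal unfolding opposite_about_def by auto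
  moreover have "gallery_around H (uminus ` F) (uminus ` D) (antipath f) (uminus ` C)"
    if "gallery_around H F C f D" for f
    using that minimal_gallery_antipath cl by (auto simp: gallery_around_def set_antipath)
  ultimately show ?thesis
    using codim2_face_antipodal[OF F] g unfolding sal_cell_def by blast
qed

lemma sal_homotopic_antipath:
  "sal_homotopic H C D p q \<Longrightarrow> sal_homotopic H (uminus ` D) (uminus ` C) (antipath p) (antipath q)"
proof (induction rule: sal_homotopic.induct)
  case (refl p)
  then show ?case by (intro sal_homotopic.refl sal_path_antipath)
next
  case (sym p q)
  show ?case by (rule sal_homotopic.sym[OF sym.IH])
next
  case (trans p q r)
  then show ?case using sal_homotopic.trans by blast
next
  case (cancel p s q)
  have i: "step_inverse (step_inverse t) = t" for t :: "'a set step" by (cases t) simp_all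
  have "antipath (p @ [s, step_inverse s] @ q)
      = antipath q @ [antistep (step_inverse s), step_inverse (antistep (step_inverse s))] @ antipath p"
    by (simp add: antipath_def antistep_inverse i)
  then show ?case
    using sal_homotopic.cancel sal_path_antipath[OF cancel] by (metis antipath_append)
next
  case (cell g g' p q)
  have "sal_path H (uminus ` D) (antipath q @ antipath g @ antipath p) (uminus ` C)"
    using sal_path_antipath[OF cell(2)] by simp
  from sal_homotopic.cell[OF sal_cell_antipath[OF cell(1)] this] show ?case by simp
qed

lemma sal_homotopic_cancel_inverse:
  assumes "sal_path H C p D" "sal_path H E q C" "sal_path H C r E'"
  shows "sal_homotopic H E E' (q @ p @ path_inverse p @ r) (q @ r)"
proof -
  have "sal_homotopic H C E' ((p @ path_inverse p) @ r) ([] @ r)"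
    by (rule sal_homotopic_append_right[OF sal_homotopic_inverse[OF assms(1)] assms(3)])
  from sal_homotopic_append_left[OF this assms(2)] show ?thesis by simp
qed

text \<open>The rule \<open>cell\<close> offers no inverted 2-cells, so there is no induction on the
  homotopy. Instead \<open>path_inverse p @ q @ path_inverse q\<close> and
  \<open>path_inverse p @ p @ path_inverse q\<close> are homotopic and cancel to the two
  sides.\<close>

lemma sal_homotopic_path_inverse:
  assumes "sal_homotopic H C D p q"
  shows "sal_homotopic H D C (path_inverse p) (path_inverse q)"
proof -
  have p: "sal_path H C p D" "sal_path H C q D" using sal_homotopic_paths[OF assms] by blast+
  note ip = sal_path_inverse[OF p(1)] and iq = sal_path_inverse[OF p(2)]
  have nil: "sal_path H D [] D" using sal_path_target[OF p(1)] by simp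
  have nilC: "sal_path H C [] C" using sal_path_source[OF p(1)] by simp
  have "sal_homotopic H D C (path_inverse p @ q @ path_inverse q @ []) (path_inverse p @ [])"
    by (rule sal_homotopic_cancel_inverse[OF p(2) ip nilC])
  moreover have "sal_homotopic H D C (path_inverse p @ p @ path_inverse q) (path_inverse p @ q @ path_inverse q)"
    by (intro sal_homotopic_append_left[OF _ ip] sal_homotopic_append_right[OF assms iq])
  moreover have "sal_homotopic H D C ([] @ path_inverse p @ path_inverse (path_inverse p) @ path_inverse q) ([] @ path_inverse q)"
    by (rule sal_homotopic_cancel_inverse[OF ip nil iq])
  ultimately show ?thesis
    by simp (meson sal_homotopic.sym sal_homotopic.trans)
qed

text \<open>The first region entered on the way from \<open>C'\<close> to \<open>C\<close> lies
  strictly above \<open>C'\<close> and weakly below \<open>C\<close>, so for a cover it is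
  \<open>C\<close> itself.\<close>

lemma weak_cover_step:
  assumes B: "B \<in> regions H" and cov: "weak_covers H B C' C"
  obtains h where "C' \<in> regions H" "C \<in> regions H" "inversions H C' C = {h}"
    "inversions H B C = insert h (inversions H B C')" "h \<notin> inversions H B C'"
proof -
  have C: "C' \<in> regions H" "C \<in> regions H" and sub: "inversions H B C' \<subset> inversions H B C"
    and no: "\<not> (\<exists>D\<in>regions H. inversions H B C' \<subset> inversions H B D \<and> inversions H B D \<subset> inversions H B C)"
    using cov by (auto simp: weak_covers_def)
  have diff: "inversions H C' C = inversions H B C - inversions H B C'"
    using inversions_sym_diff[OF C(1) B C(2)] inversions_commute[OF B C(1)] sub by auto
  have "C' \<noteq> C" using sub by blast
  then obtain E h where E: "E \<in> regions H" "inversions H C' E = {h}" "h \<in> inversions H C' C"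
    using first_step_exists[OF C] by blast
  have BE: "inversions H B E = insert h (inversions H B C')"
    using inversions_sym_diff[OF B C(1) E(1)] E(2,3) diff by auto
  have "inversions H B C' \<subset> inversions H B E" "inversions H B E \<subseteq> inversions H B C"
    using BE E(3) diff sub by auto
  then have "inversions H B E = inversions H B C"
    using no E(1) by (metis psubsetI)
  then have "E = C" using inversions_inject[OF B E(1) C(2)] by blast
  moreover have "h \<notin> inversions H B C'" using E(3) diff by blast
  ultimately show ?thesis using that[OF C, of h] E(2) BE by simp
qed

lemma weak_cover_of_step:
  assumes "B \<in> regions H" "C' \<in> regions H" "C \<in> regions H"
    "inversions H B C = insert h (inversions H B C')" "h \<notin> inversions H B C'"
  shows "weak_covers H B C' C"
  using assms unfolding weak_covers_def by auto

end

section \<open>The induced involution of the fundamental group\<close>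

locale based_arrangement = arrangement +
  fixes B
  assumes base: "B \<in> regions H"
begin

abbreviation G where "G \<equiv> sal_pi1 H B"

abbreviation M where "M \<equiv> pure_shard_monoid H B"

abbreviation half_twist where "half_twist \<equiv> gal H B (uminus ` B)"

definition dual_path :: "'a set step list \<Rightarrow> 'a set step list" where
  "dual_path p = half_twist @ antipath p @ path_inverse half_twist"

text \<open>The union over all representatives avoids choosing one; \<open>dual_class\<close> shows
  that they all yield the same class.\<close>

definition dual :: "'a set step list set \<Rightarrow> 'a set step list set" where
  "dual X = (\<Union>p\<in>X. homotopy_class H B (dual_path p))"

lemma antipode: "uminus ` B \<in> regions H"
  by (rule antipodal_region[OF base])

lemma half_twist: "minimal_gallery H B half_twist (uminus ` B)"
  by (rule gal[OF base antipode])

lemma half_twist_path: "sal_path H B half_twist (uminus ` B)"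
  by (rule minimal_gallery_path[OF half_twist])

text \<open>Both are minimal galleries from B to -B. This symmetry is what makes \<open>dual\<close>
  an involution.\<close>

lemma antipath_half_twist: "sal_homotopic H B (uminus ` B) (antipath half_twist) half_twist"
  using minimal_gallery_antipath[OF half_twist] half_twist
  by (simp add: image_image minimal_galleries_homotopic)

lemma carrier_G: "carrier G = {homotopy_class H B p | p. sal_path H B p B}"
  by (simp add: sal_pi1_def)

lemma conjugate_loop:
  assumes "sal_path H C p C" "sal_path H B q C"
  shows "sal_path H B (q @ p @ path_inverse q) B"
  using assms sal_path_inverse[OF assms(2)] by (auto simp: sal_path_append)

lemma dual_path_loop: "sal_path H B p B \<Longrightarrow> sal_path H B (dual_path p) B"
  unfolding dual_path_def by (rule conjugate_loop[OF sal_path_antipath half_twist_path])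

lemma dual_path_cong:
  assumes "sal_homotopic H B B p q"
  shows "sal_homotopic H B B (dual_path p) (dual_path q)"
  unfolding dual_path_def
  by (intro sal_homotopic_append_left[OF _ half_twist_path]
      sal_homotopic_append_right[OF _ sal_path_inverse[OF half_twist_path]]
      sal_homotopic_antipath assms)

lemma dual_class:
  assumes "sal_path H B p B"
  shows "dual (homotopy_class H B p) = homotopy_class H B (dual_path p)"
proof -
  have "homotopy_class H B (dual_path q) = homotopy_class H B (dual_path p)"
    if "q \<in> homotopy_class H B p" for q
  proof -
    have "sal_homotopic H B B p q" using that by (simp add: homotopy_class_def)
    then show ?thesis
      using dual_path_cong homotopy_class_eq_iff[OF dual_path_loop[OF assms]] by metis
  qed
  moreover have "p \<in> homotopy_class H B p"
    using assms by (simp add: homotopy_class_def sal_homotopic.refl)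
  ultimately show ?thesis unfolding dual_def by blast
qed

lemma dual_carrier: "X \<in> carrier G \<Longrightarrow> dual X \<in> carrier G"
  unfolding carrier_G using dual_class dual_path_loop by blast

text \<open>\<open>antipath\<close> reverses the order of the factors, and the inverse half twist
  ending the first dual path cancels the half twist starting the second.\<close>

lemma dual_mult:
  assumes "X \<in> carrier G" "Y \<in> carrier G"
  shows "dual (X \<otimes>\<^bsub>G\<^esub> Y) = dual Y \<otimes>\<^bsub>G\<^esub> dual X"
proof -
  obtain p q where p: "sal_path H B p B" "X = homotopy_class H B p"
    and q: "sal_path H B q B" "Y = homotopy_class H B q"
    using assms unfolding carrier_G by blast
  have pq: "sal_path H B (p @ q) B" using p q by (auto simp: sal_path_append)
  have "sal_path H (uminus ` B) (path_inverse half_twist) B"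
    by (rule sal_path_inverse[OF half_twist_path])
  moreover have "sal_path H B (half_twist @ antipath q) (uminus ` B)"
    "sal_path H (uminus ` B) (antipath p @ path_inverse half_twist) B"
    using half_twist_path sal_path_antipath[OF p(1)] sal_path_antipath[OF q(1)] calculation
    by (auto simp: sal_path_append)
  ultimately have "sal_homotopic H B B
      ((half_twist @ antipath q) @ path_inverse half_twist @ path_inverse (path_inverse half_twist)
        @ antipath p @ path_inverse half_twist)
      ((half_twist @ antipath q) @ antipath p @ path_inverse half_twist)"
    by (rule sal_homotopic_cancel_inverse)
  then have "sal_homotopic H B B (dual_path q @ dual_path p) (dual_path (p @ q))"
    by (simp add: dual_path_def)
  then have "homotopy_class H B (dual_path q @ dual_path p) = homotopy_class H B (dual_path (p @ q))"
    using homotopy_class_eq_iff sal_homotopic_paths by blast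
  then show ?thesis
    using p q pq by (simp add: sal_pi1_mult dual_class dual_path_loop)
qed

text \<open>Applying \<open>dual_path\<close> twice conjugates \<open>p\<close> by the half twist
  followed by the inverse of its antipodal image, and this loop is null-homotopic.\<close>

lemma dual_dual:
  assumes "X \<in> carrier G"
  shows "dual (dual X) = X"
proof -
  obtain p where p: "sal_path H B p B" "X = homotopy_class H B p"
    using assms unfolding carrier_G by blast
  let ?t = "half_twist" and ?u = "antipath half_twist"
  have t: "sal_path H B ?t (uminus ` B)" and u: "sal_path H B ?u (uminus ` B)"
    using sal_homotopic_paths[OF antipath_half_twist] by blast+
  have "sal_homotopic H B B (?t @ path_inverse ?u) (?t @ path_inverse ?t)"
    by (rule sal_homotopic_append_left[OF sal_homotopic_path_inverse[OF antipath_half_twist] t])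
  then have 1: "sal_homotopic H B B (?t @ path_inverse ?u) []"
    using sal_homotopic_inverse[OF t] sal_homotopic.trans by blast
  have "sal_homotopic H B B (?u @ path_inverse ?t) (?t @ path_inverse ?t)"
    by (rule sal_homotopic_append_right[OF antipath_half_twist sal_path_inverse[OF t]])
  then have 2: "sal_homotopic H B B (?u @ path_inverse ?t) []"
    using sal_homotopic_inverse[OF t] sal_homotopic.trans by blast
  have "sal_homotopic H B B ((?t @ path_inverse ?u) @ p @ (?u @ path_inverse ?t)) ([] @ p @ [])"
    by (intro sal_homotopic_append[OF 1] sal_homotopic_append[OF _ 2] sal_homotopic.refl p(1))
  then have h: "sal_homotopic H B B (dual_path (dual_path p)) p"
    by (simp add: dual_path_def antipath_inverse)
  have "dual (dual X) = homotopy_class H B (dual_path (dual_path p))"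
    using p by (simp add: dual_class dual_path_loop)
  also have "\<dots> = X"
    using h p homotopy_class_eq_iff sal_homotopic_paths by blast
  finally show ?thesis .
qed

text \<open>Each of the two galleries is homotopic to its antipodal image, as both are minimal with
  the same ends. With u the gallery from -B to B, the dual of Delta u is thus Delta u Delta
  Delta^{-1}.\<close>

lemma full_twist_carrier: "full_twist H B \<in> carrier G"
  and dual_full_twist: "dual (full_twist H B) = full_twist H B"
proof -
  let ?t = "half_twist" and ?u = "gal H (uminus ` B) B"
  have u: "minimal_gallery H (uminus ` B) ?u B" by (rule gal[OF antipode base])
  have tu: "sal_path H B (?t @ ?u) B"
    using half_twist_path minimal_gallery_path[OF u] by (auto simp: sal_path_append)
  have ft: "full_twist H B = homotopy_class H B (?t @ ?u)"
    by (simp add: full_twist_def opposite_eq base)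
  with tu show "full_twist H B \<in> carrier G" unfolding carrier_G by blast
  have "minimal_gallery H (uminus ` B) (antipath ?u) B"
    using minimal_gallery_antipath[OF u] by (simp add: image_image)
  then have au: "sal_homotopic H (uminus ` B) B (antipath ?u) ?u"
    using u by (rule minimal_galleries_homotopic)
  have "sal_homotopic H B B (?t @ antipath ?u @ antipath ?t @ path_inverse ?t)
      (?t @ ?u @ ?t @ path_inverse ?t)"
    by (intro sal_homotopic_append_left[OF _ half_twist_path] sal_homotopic_append[OF au]
        sal_homotopic_append_right[OF antipath_half_twist sal_path_inverse[OF half_twist_path]])
  moreover have "sal_homotopic H B B ((?t @ ?u) @ ?t @ path_inverse ?t @ []) ((?t @ ?u) @ [])"
    using base by (intro sal_homotopic_cancel_inverse[OF half_twist_path tu]) simp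
  ultimately have "sal_homotopic H B B (dual_path (?t @ ?u)) (?t @ ?u)"
    using sal_homotopic.trans by (simp add: dual_path_def) blast
  then have "homotopy_class H B (dual_path (?t @ ?u)) = homotopy_class H B (?t @ ?u)"
    using homotopy_class_eq_iff sal_homotopic_paths by blast
  then show "dual (full_twist H B) = full_twist H B" by (simp add: ft dual_class tu)
qed

lemma cover_loop_path:
  assumes "sal_path H B g C'" "adjacent H C' C" "adjacent H C C'"
  shows "sal_path H B (g @ [Fwd C' C, Fwd C C'] @ path_inverse g) B"
  using assms by (intro conjugate_loop) (auto simp: adjacent_def)

lemma dual_shard_loop:
  assumes cov: "weak_covers H B C' C"
  shows "shard_loop H B C' C \<in> carrier G"
    and "dual (shard_loop H B C' C) = shard_loop H B (uminus ` C) (uminus ` C')"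
    and "weak_covers H B (uminus ` C) (uminus ` C')"
proof -
  obtain h where C: "C' \<in> regions H" "C \<in> regions H" "inversions H C' C = {h}"
    "inversions H B C = insert h (inversions H B C')" "h \<notin> inversions H B C'"
    using weak_cover_step[OF base cov] .
  let ?n = "image uminus :: 'a set \<Rightarrow> 'a set"
  have n: "?n C \<in> regions H" "?n C' \<in> regions H" using antipodal_region C by blast+
  have hH: "h \<in> H" using C(3) inversions_subset by blast
  \<comment> \<open>Complementing inversion sets reverses the cover: -C lies below -C'.\<close>
  have "inversions H B (?n C') = insert h (inversions H B (?n C))" "h \<notin> inversions H B (?n C)"
    using inversions_antipodal_right[OF base C(1)] inversions_antipodal_right[OF base C(2)] C(4,5) hH
    by auto
  then show "weak_covers H B (?n C) (?n C')" by (rule weak_cover_of_step[OF base n])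
  let ?g = "gal H B C'" and ?t = half_twist and ?k = "gal H B (?n C)"
  let ?f = "Fwd (?n C) (?n C')" and ?f' = "Fwd (?n C') (?n C)"
  have g: "minimal_gallery H B ?g C'" and k: "minimal_gallery H B ?k (?n C)"
    using gal base C n by blast+
  have adj: "adjacent H C' C" "adjacent H C C'"
    using C inversions_commute[OF C(1,2)] by (auto simp: adjacent_iff)
  have adjn: "adjacent H (?n C) (?n C')" "adjacent H (?n C') (?n C)"
    using adj adjacent_antipodal by blast+
  have lp: "sal_path H B (?g @ [Fwd C' C, Fwd C C'] @ path_inverse ?g) B"
    by (rule cover_loop_path[OF minimal_gallery_path[OF g] adj])
  show "shard_loop H B C' C \<in> carrier G"
    unfolding shard_loop_def carrier_G using lp by blast
  define a where "a = antipath ?g"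
  have a: "minimal_gallery H (?n C') a (?n B)" unfolding a_def by (rule minimal_gallery_antipath[OF g])
  have "minimal_gallery H (?n C) (?f # a) (?n B)"
  proof -
    have "inversions H (?n C) (?n C') = {h}"
      using inversions_antipodal[OF C(1,2)] C(3) by simp
    moreover have "h \<in> inversions H (?n C) (?n B)"
      using inversions_antipodal[OF base C(2)] C(4) by simp
    ultimately show ?thesis using a n by (auto simp: minimal_gallery_Cons)
  qed
  \<comment> \<open>What \<open>?k\<close> crosses is complementary to what the rest crosses, so the
    composite is minimal from B to -B and can replace the half twist.\<close>
  then have "minimal_gallery H B (?k @ ?f # a) (?n B)"
    using inversions_antipodal_right[OF base C(2)] inversions_antipodal[OF base C(2)]
    by (intro minimal_gallery_append[OF k]) auto
  then have t: "sal_homotopic H B (?n B) ?t (?k @ [?f] @ a)"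
    using minimal_galleries_homotopic half_twist by simp
  have ap: "sal_path H (?n C') a (?n B)" using a by (rule minimal_gallery_path)
  have kp: "sal_path H B ?k (?n C)" using k by (rule minimal_gallery_path)
  have ff: "sal_path H (?n C') [?f', ?f] (?n C')" "sal_path H (?n C) [?f] (?n C')"
    "sal_path H (?n C') [?f'] (?n C)"
    using adjn n by simp_all
  have kf: "sal_path H B (?k @ [?f]) (?n C')"
    using kp ff(2) sal_path_append by blast
  have loop: "sal_path H (?n B) (path_inverse a @ [?f', ?f] @ a) (?n B)"
    using ap sal_path_inverse[OF ap] ff(1) sal_path_append by blast
  \<comment> \<open>The dual loop is a^{-1} f' f a conjugated by k f a. Cancelling a against its
    inverse on both sides leaves k f f' f f^{-1} k^{-1}, and cancelling the last f gives the loop of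
    the edge f.\<close>
  have "sal_homotopic H B B (?t @ (path_inverse a @ [?f', ?f] @ a) @ path_inverse ?t)
     ((?k @ [?f] @ a) @ (path_inverse a @ [?f', ?f] @ a) @ path_inverse (?k @ [?f] @ a))"
    by (rule sal_homotopic_append[OF t sal_homotopic_append[OF
          sal_homotopic.refl[OF loop] sal_homotopic_path_inverse[OF t]]])
  also have "(?k @ [?f] @ a) @ (path_inverse a @ [?f', ?f] @ a) @ path_inverse (?k @ [?f] @ a)
     = (?k @ [?f]) @ a @ path_inverse a @ [?f', ?f] @ a @ path_inverse a @ path_inverse (?k @ [?f])"
    by (simp add: path_inverse_def)
  finally have 1: "sal_homotopic H B B (?t @ (path_inverse a @ [?f', ?f] @ a) @ path_inverse ?t)
     \<dots>" .
  have kfi: "sal_path H (?n C') (path_inverse (?k @ [?f])) B" by (rule sal_path_inverse[OF kf])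
  have rest: "sal_path H (?n C') ([?f', ?f] @ a @ path_inverse a @ path_inverse (?k @ [?f])) B"
    using ap sal_path_inverse[OF ap] ff(1) kfi sal_path_append by blast
  have 2: "sal_homotopic H B B
      ((?k @ [?f]) @ a @ path_inverse a @ ([?f', ?f] @ a @ path_inverse a @ path_inverse (?k @ [?f])))
      ((?k @ [?f]) @ ([?f', ?f] @ a @ path_inverse a @ path_inverse (?k @ [?f])))"
    by (rule sal_homotopic_cancel_inverse[OF ap kf rest])
  have kff: "sal_path H B (?k @ [?f] @ [?f', ?f]) (?n C')"
    using kf ff(1) sal_path_append by (metis append_assoc)
  have 3: "sal_homotopic H B B
      ((?k @ [?f] @ [?f', ?f]) @ a @ path_inverse a @ path_inverse (?k @ [?f]))
      ((?k @ [?f] @ [?f', ?f]) @ path_inverse (?k @ [?f]))"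
    by (rule sal_homotopic_cancel_inverse[OF ap kff kfi])
  have kff': "sal_path H B (?k @ [?f, ?f']) (?n C)"
    using kp ff(2,3) adjn n sal_path_append[of H B ?k "[?f, ?f']"] by auto
  have 4: "sal_homotopic H B B
      ((?k @ [?f, ?f']) @ [?f] @ path_inverse [?f] @ path_inverse ?k)
      ((?k @ [?f, ?f']) @ path_inverse ?k)"
    by (rule sal_homotopic_cancel_inverse[OF ff(2) kff' sal_path_inverse[OF kp]])
  have "sal_homotopic H B B (?t @ (path_inverse a @ [?f', ?f] @ a) @ path_inverse ?t)
     (?k @ [?f, ?f'] @ path_inverse ?k)"
    using sal_homotopic.trans[OF 1] sal_homotopic.trans[OF 2] sal_homotopic.trans[OF 3] 4
    by (simp add: path_inverse_def)
  moreover have "antipath [Fwd C' C, Fwd C C'] = [?f', ?f]" by (simp add: antipath_def)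
  then have "antipath (?g @ [Fwd C' C, Fwd C C'] @ path_inverse ?g) = path_inverse a @ [?f', ?f] @ a"
    by (simp only: antipath_append antipath_inverse a_def append_assoc)
  ultimately have "sal_homotopic H B B (dual_path (?g @ [Fwd C' C, Fwd C C'] @ path_inverse ?g))
      (?k @ [?f, ?f'] @ path_inverse ?k)"
    by (simp only: dual_path_def)
  then have "homotopy_class H B (dual_path (?g @ [Fwd C' C, Fwd C C'] @ path_inverse ?g))
      = homotopy_class H B (?k @ [?f, ?f'] @ path_inverse ?k)"
    using homotopy_class_eq_iff sal_homotopic_paths by blast
  then show "dual (shard_loop H B C' C) = shard_loop H B (uminus ` C) (uminus ` C')"
    by (simp only: shard_loop_def dual_class[OF lp])
qed

section \<open>Duality of the interval\<close>

lemma group_G: "group G"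
  by (rule group_sal_pi1[OF base])

lemma submonoid_M: "submonoid M G"
proof -
  interpret group G by (rule group_G)
  \<comment> \<open>The carrier itself belongs to the intersected family, which places
    \<open>M\<close> inside it.\<close>
  have "submonoid (carrier G) G" by unfold_locales auto
  then have "M \<subseteq> carrier G"
    unfolding pure_shard_monoid_def using dual_shard_loop(1) by blast
  then show ?thesis
  proof (rule submonoid.intro)
    show "x \<otimes>\<^bsub>G\<^esub> y \<in> M" if "x \<in> M" "y \<in> M" for x y
      using that unfolding pure_shard_monoid_def by (auto intro: submonoid.m_closed)
    show "\<one>\<^bsub>G\<^esub> \<in> M"
      unfolding pure_shard_monoid_def by (auto intro: submonoid.one_closed)
  qed
qed

text \<open>An anti-homomorphism sends the identity to an idempotent, and a group has only
  one.\<close>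

lemma dual_one: "dual \<one>\<^bsub>G\<^esub> = \<one>\<^bsub>G\<^esub>"
proof -
  interpret group G by (rule group_G)
  have "dual \<one>\<^bsub>G\<^esub> \<otimes>\<^bsub>G\<^esub> dual \<one>\<^bsub>G\<^esub> = dual \<one>\<^bsub>G\<^esub>"
    using dual_mult[of "\<one>\<^bsub>G\<^esub>" "\<one>\<^bsub>G\<^esub>"] by simp
  then show ?thesis using dual_carrier[of "\<one>\<^bsub>G\<^esub>"] by simp
qed

text \<open>The elements that \<open>dual\<close> sends into \<open>M\<close> form a submonoid
  containing every generator, and \<open>M\<close> lies in each such submonoid.\<close>

lemma dual_M:
  assumes "X \<in> M"
  shows "dual X \<in> M"
proof -
  interpret group G by (rule group_G)
  interpret M: submonoid M G by (rule submonoid_M)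
  let ?N = "{X \<in> carrier G. dual X \<in> M}"
  have "submonoid ?N G"
    by (rule submonoid.intro) (auto simp: dual_mult dual_one)
  moreover have "shard_loop H B C' C \<in> ?N" if "weak_covers H B C' C" for C' C
    using dual_shard_loop[OF that] by (auto simp: pure_shard_monoid_def)
  ultimately have "M \<subseteq> ?N"
    unfolding pure_shard_monoid_def by blast
  then show ?thesis using assms by blast
qed

text \<open>The identity is below every element of \<open>M\<close>, and a factorisation of the full
  twist within \<open>M\<close> puts the full twist in \<open>M\<close>. So the interval is exactly
  the set of left divisors treated in \<open>self_dual_on_divisors\<close>.\<close>

lemma self_dual_shard_interval:
  "self_dual_on (shard_interval H B \<one>\<^bsub>G\<^esub> (full_twist H B)) (shard_le H B)"
proof -
  interpret group G by (rule group_G)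
  interpret M: submonoid M G by (rule submonoid_M)
  have le: "shard_le H B = (\<lambda>x y. x \<in> M \<and> y \<in> M \<and> (\<exists>q\<in>M. y = x \<otimes>\<^bsub>G\<^esub> q))"
    by (intro ext) (simp add: shard_le_def)
  have "shard_interval H B \<one>\<^bsub>G\<^esub> (full_twist H B) = {x\<in>M. \<exists>q\<in>M. full_twist H B = x \<otimes>\<^bsub>G\<^esub> q}"
    by (auto simp: shard_interval_def le)
  then show ?thesis
    unfolding le
    using self_dual_on_divisors[OF submonoid_M, of dual] dual_carrier dual_mult dual_dual dual_M
      full_twist_carrier dual_full_twist by auto
qed

end

theorem theorem1p2:
  fixes \<H> :: "(real ^ 'n) set set" and B :: "(real ^ 'n) set"
  assumes "central_arrangement \<H>"
    and "irreducible_arrangement \<H>"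
    and "B \<in> regions \<H>"
  shows "self_dual_on
           (shard_interval \<H> B \<one>\<^bsub>sal_pi1 \<H> B\<^esub> (full_twist \<H> B))
           (shard_le \<H> B)"
proof -
  interpret based_arrangement \<H> B
    using assms by unfold_locales auto
  show ?thesis by (rule self_dual_shard_interval)
qed

end
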